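(* Let $K$ be a field, $S=K[x_1,\ldots,x_n]$, $I$ a monomial ideal of $S$, and let $u_1,\ldots,u_r$ be monomials in $S$ forming a filter-regular sequence on $S/I$. Then Stanley's conjecture holds for $S/I$ if and only if it holds for $S/(I,u_1,\ldots,u_r)$; that is, $\operatorname{depth} S/I\le\operatorname{sdepth} S/I$ if and only if $\operatorname{depth} S/(I,u_1,\ldots,u_r)\le\operatorname{sdepth} S/(I,u_1,\ldots,u_r)$.
   Context: $S=K[x_1,\ldots,x_n]$ carries its standard $\mathbb{Z}^n$-grading (``multigrading''), and $\mathfrak{m}=(x_1,\ldots,x_n)$. Filter-regular sequence: for a finitely generated multigraded $S$-module $M$, a non-unit monomial $u\in S$ is a filter-regular element on $M$ if $u\notin\bigcup_{\mathfrak{p}\in \operatorname{Ass}_S M\setminus\{\mathfrak{m}\}}\mathfrak{p}$. A sequence $u_1,\ldots,u_r$ of non-unit monomials in $S$ is a filter-regular sequence on $M$ if for each $1\le i\le r$, $u_i$ is a filter-regular element on $M/(u_1,\ldots,u_{i-1})M$. Stanley depth: for a monomial ideal $J$ of $S$, a Stanley decomposition of $S/J$ is a decomposition as a direct sum of $K$-vector spaces $\mathcal{D}: S/J=\bigoplus_{i=1}^s v_iK[Z_i]$, where each $v_i$ is a monomial in $S$ and $Z_i\subseteq\{x_1,\ldots,x_n\}$. Its Stanley depth is $\operatorname{sdepth}\mathcal{D}=\min\{|Z_i| : i=1,\ldots,s\}$, and $\operatorname{sdepth} S/J=\max\{\operatorname{sdepth}\mathcal{D} : \mathcal{D}\text{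 is a Stanley decomposition of } S/J\}$. Stanley's conjecture holds for $S/J$ if $\operatorname{depth} S/J\le\operatorname{sdepth} S/J$. *)

theory Defs
  imports "HOL-Algebra.Module" "HOL-Algebra.QuotRing"
    "HOL-Library.Poly_Mapping" "HOL-Library.Extended_Nat"
begin

section \<open>Quotient modules, associated primes and regular sequences\<close>

text \<open>The fields \<^const>\<open>mult\<close> and \<^const>\<open>one\<close> of a module record play no role in the locale
  \<^locale>\<open>Module.module\<close>; they are left unspecified below.\<close>

definition regular_module :: "('a, 'b) ring_scheme \<Rightarrow> ('a, 'a) module" where
  "regular_module R =
    \<lparr>carrier = carrier R, mult = undefined, one = undefined, zero = \<zero>\<^bsub>R\<^esub>, add = add R,
     smult = mult R\<rparr>"

definition quot_module :: "('a, 'b, 'c) module_scheme \<Rightarrow> 'b set \<Rightarrow> ('a, 'b set) module" where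
  "quot_module M N =
    \<lparr>carrier = a_rcosets\<^bsub>M\<^esub> N, mult = undefined, one = undefined, zero = N, add = set_add M,
     smult = (\<lambda>a X. \<Union>x\<in>X. N +>\<^bsub>M\<^esub> (a \<odot>\<^bsub>M\<^esub> x))\<rparr>"

text \<open>The submodule \<open>I M\<close>, generated by all products \<open>a m\<close> with \<open>a \<in> I\<close> and \<open>m \<in> M\<close>.\<close>

definition ideal_smult ::
    "('a, 'b) ring_scheme \<Rightarrow> 'a set \<Rightarrow> ('a, 'c, 'd) module_scheme \<Rightarrow> 'c set" where
  "ideal_smult R I M =
    \<Inter>{N. submodule N R M \<and> (\<forall>a\<in>I. \<forall>m\<in>carrier M. a \<odot>\<^bsub>M\<^esub> m \<in> N)}"

definition Ass :: "('a, 'b) ring_scheme \<Rightarrow> ('a, 'c, 'd) module_scheme \<Rightarrow> 'a set set" where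
  "Ass R M =
    {P. primeideal P R \<and> (\<exists>m\<in>carrier M. P = {a \<in> carrier R. a \<odot>\<^bsub>M\<^esub> m = \<zero>\<^bsub>M\<^esub>})}"

definition regular_elem ::
    "('a, 'c, 'd) module_scheme \<Rightarrow> 'a \<Rightarrow> bool" where
  "regular_elem M a \<longleftrightarrow> (\<forall>m\<in>carrier M. a \<odot>\<^bsub>M\<^esub> m = \<zero>\<^bsub>M\<^esub> \<longrightarrow> m = \<zero>\<^bsub>M\<^esub>)"

text \<open>For a list \<open>as\<close> of ring elements, \<open>quot_by R M as\<close> is \<open>M / (as) M\<close>.\<close>

definition quot_by ::
    "('a, 'b) ring_scheme \<Rightarrow> ('a, 'c, 'd) module_scheme \<Rightarrow> 'a list \<Rightarrow> ('a, 'c set) module" where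
  "quot_by R M as = quot_module M (ideal_smult R (Idl\<^bsub>R\<^esub> (set as)) M)"

definition regular_seq ::
    "('a, 'b) ring_scheme \<Rightarrow> ('a, 'c, 'd) module_scheme \<Rightarrow> 'a list \<Rightarrow> bool" where
  "regular_seq R M as \<longleftrightarrow>
    (\<forall>i<length as. regular_elem (quot_by R M (take i as)) (as ! i)) \<and>
    carrier (quot_by R M as) \<noteq> {\<zero>\<^bsub>quot_by R M as\<^esub>}"

section \<open>The polynomial ring\<close>

text \<open>A polynomial over \<open>'k\<close> in the variables \<open>x\<^sub>i\<close>, \<open>i :: 'n\<close>, is a finitely supported function
  from exponent vectors to coefficients. The number of variables is the cardinality of the
  finite type \<open>'n\<close>.\<close>

type_synonym ('n, 'k) mpol = "('n \<Rightarrow>\<^sub>0 nat) \<Rightarrow>\<^sub>0 'k"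

definition poly_ring :: "('n::finite, 'k::field) mpol ring" where
  "poly_ring = \<lparr>carrier = UNIV, mult = (*), one = 1, zero = 0, add = (+)\<rparr>"

definition monomial :: "('n::finite, 'k::field) mpol \<Rightarrow> bool" where
  "monomial u \<longleftrightarrow> (\<exists>a. u = Poly_Mapping.single a 1)"

definition var :: "'n \<Rightarrow> ('n::finite, 'k::field) mpol" where
  "var i = Poly_Mapping.single (Poly_Mapping.single i 1) 1"

definition max_ideal :: "('n::finite, 'k::field) mpol set" where
  "max_ideal = Idl\<^bsub>poly_ring\<^esub> (range var)"

definition monomial_ideal :: "('n::finite, 'k::field) mpol set \<Rightarrow> bool" where
  "monomial_ideal I \<longleftrightarrow> (\<exists>G. (\<forall>g\<in>G. monomial g) \<and> I = Idl\<^bsub>poly_ring\<^esub> G)"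

text \<open>The \<open>S\<close>-module \<open>S/J\<close>.\<close>

abbreviation S_mod ::
    "('n::finite, 'k::field) mpol set \<Rightarrow> (('n, 'k) mpol, ('n, 'k) mpol set) module" where
  "S_mod J \<equiv> quot_module (regular_module poly_ring) J"

section \<open>Depth and filter-regular sequences\<close>

text \<open>The depth is the maximal length of a regular sequence contained in the graded maximal
  ideal; the zero module has infinite depth by convention.\<close>

definition depth :: "(('n::finite, 'k::field) mpol, 'c, 'd) module_scheme \<Rightarrow> enat" where
  "depth M =
    (if carrier M = {\<zero>\<^bsub>M\<^esub>} then \<infinity>
     else SUP as\<in>{as. set as \<subseteq> max_ideal \<and> regular_seq poly_ring M as}. enat (length as))"

definition filter_regular_elem ::
    "(('n::finite, 'k::field) mpol, 'c, 'd) module_scheme \<Rightarrow> ('n, 'k) mpol \<Rightarrow> bool" where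
  "filter_regular_elem M u \<longleftrightarrow>
    monomial u \<and> u \<notin> Units poly_ring \<and> u \<notin> \<Union>(Ass poly_ring M - {max_ideal})"

definition filter_regular_seq ::
    "(('n::finite, 'k::field) mpol, 'c, 'd) module_scheme \<Rightarrow> ('n, 'k) mpol list \<Rightarrow> bool" where
  "filter_regular_seq M us \<longleftrightarrow>
    (\<forall>i<length us. filter_regular_elem (quot_by poly_ring M (take i us)) (us ! i))"

section \<open>Stanley depth\<close>

text \<open>\<open>v K[Z]\<close>, as a \<open>K\<close>-subspace of the polynomial ring.\<close>

definition stanley_space ::
    "('n::finite, 'k::field) mpol \<Rightarrow> 'n set \<Rightarrow> ('n, 'k) mpol set" where
  "stanley_space v Z =
    (\<lambda>f. v * f) ` {f. \<forall>a\<in>Poly_Mapping.keys f. Poly_Mapping.keys a \<subseteq> Z}"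

text \<open>In a decomposition \<open>S/J = \<Oplus>\<^sub>i v\<^sub>i K[Z\<^sub>i]\<close>, the summand \<open>v\<^sub>i K[Z\<^sub>i]\<close> is a free \<open>K[Z\<^sub>i]\<close>-module
  and is embedded into \<open>S/J\<close> by taking residue classes. Hence the decomposition means that the
  \<open>K\<close>-linear map from the external direct sum of the \<open>v\<^sub>i K[Z\<^sub>i]\<close> to \<open>S/J\<close>, sending a family
  \<open>(f\<^sub>i)\<^sub>i\<close> to the residue class of its sum, is bijective. (Without injectivity on the individual
  summands, \<open>K[x]/(x\<^sup>2) = 1 K[x]\<close> would be a decomposition.)\<close>

definition stanley_decomposition ::
    "('n::finite, 'k::field) mpol set \<Rightarrow> (('n, 'k) mpol \<times> 'n set) list \<Rightarrow> bool" where
  "stanley_decomposition J D \<longleftrightarrow>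
    (\<forall>(v, Z)\<in>set D. monomial v) \<and>
    (\<forall>X\<in>carrier (S_mod J).
      \<exists>!fs. list_all2 (\<lambda>f (v, Z). f \<in> stanley_space v Z) fs D \<and>
            J +>\<^bsub>poly_ring\<^esub> sum_list fs = X)"

text \<open>In \<^typ>\<open>enat\<close>, the minimum of the empty set is \<open>\<infinity>\<close>. This occurs only for the empty
  decomposition of the zero ring, which therefore has infinite Stanley depth.\<close>

definition sdepth_decomposition :: "(('n::finite, 'k::field) mpol \<times> 'n set) list \<Rightarrow> enat" where
  "sdepth_decomposition D = (INF (v, Z)\<in>set D. enat (card Z))"

text \<open>\<open>sdepth J\<close> is the Stanley depth of \<open>S/J\<close>.\<close>

definition sdepth :: "('n::finite, 'k::field) mpol set \<Rightarrow> enat" where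
  "sdepth J = (SUP D\<in>{D. stanley_decomposition J D}. sdepth_decomposition D)"

definition stanley_conjecture :: "('n::finite, 'k::field) mpol set \<Rightarrow> bool" where
  "stanley_conjecture J \<longleftrightarrow> depth (S_mod J) \<le> sdepth J"

section \<open>Well-formedness\<close>

lemma poly_ring_cring: "cring (poly_ring :: ('n::finite, 'k::field) mpol ring)"
  unfolding poly_ring_def
proof (rule cringI)
  show "abelian_group \<lparr>carrier = UNIV :: ('n, 'k) mpol set, mult = (*), one = 1, zero = 0, add = (+)\<rparr>"
  proof (rule abelian_groupI, goal_cases)
    case (6 x)
    show ?case by (rule bexI[of _ "- x"]) simp_all
  qed (simp_all add: add_ac)
  show "Group.comm_monoid
      \<lparr>carrier = UNIV :: ('n, 'k) mpol set, mult = (*), one = 1, zero = 0, add = (+)\<rparr>"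
    by (rule comm_monoidI) (auto simp: mult.assoc mult.commute)
qed (auto simp: distrib_right)

lemma (in cring) regular_module_module: "Module.module R (regular_module R)"
proof (rule moduleI)
  show "abelian_group (regular_module R)"
  proof (rule abelian_groupI, goal_cases)
    case (6 x)
    then show ?case by (intro bexI[of _ "\<ominus> x"]) (simp_all add: regular_module_def l_neg)
  qed (simp_all add: regular_module_def a_ac)
qed (auto simp: regular_module_def l_distr r_distr m_assoc is_cring)

lemma (in Module.module) quot_module_smult:
  assumes N: "submodule N R M" and "a \<in> carrier R" "x \<in> carrier M"
  shows "a \<odot>\<^bsub>quot_module M N\<^esub> (N +>\<^bsub>M\<^esub> x) = N +>\<^bsub>M\<^esub> (a \<odot>\<^bsub>M\<^esub> x)"
proof -
  interpret A: abelian_subgroup N M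
    by (rule abelian_subgroupI3)
       (auto intro!: additive_subgroup.intro submodule.axioms(1)[OF N] M.abelian_group_axioms)
  have eq: "N +>\<^bsub>M\<^esub> (a \<odot>\<^bsub>M\<^esub> y) = N +>\<^bsub>M\<^esub> (a \<odot>\<^bsub>M\<^esub> x)" if "y \<in> N +>\<^bsub>M\<^esub> x" for y
  proof -
    from that obtain h where h: "h \<in> N" "y = h \<oplus>\<^bsub>M\<^esub> x"
      by (auto simp: a_r_coset_def r_coset_def)
    then have "a \<odot>\<^bsub>M\<^esub> y = (a \<odot>\<^bsub>M\<^esub> h) \<oplus>\<^bsub>M\<^esub> (a \<odot>\<^bsub>M\<^esub> x)"
      using assms A.a_Hcarr by (simp add: smult_r_distr)
    moreover have "a \<odot>\<^bsub>M\<^esub> h \<in> N"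
      using submodule.smult_closed[OF N] assms h by blast
    ultimately have "a \<odot>\<^bsub>M\<^esub> y \<in> N +>\<^bsub>M\<^esub> (a \<odot>\<^bsub>M\<^esub> x)"
      by (auto simp: a_r_coset_def r_coset_def)
    then show ?thesis
      by (rule A.a_repr_independence'[OF _ smult_closed, symmetric]) (use assms in auto)
  qed
  have "x \<in> N +>\<^bsub>M\<^esub> x"
    using assms A.a_rcos_self by blast
  then have "(\<Union>y\<in>N +>\<^bsub>M\<^esub> x. N +>\<^bsub>M\<^esub> (a \<odot>\<^bsub>M\<^esub> y)) = N +>\<^bsub>M\<^esub> (a \<odot>\<^bsub>M\<^esub> x)"
    using eq by blast
  then show ?thesis
    by (simp add: quot_module_def)
qed

lemma (in Module.module) quot_module_module:
  assumes N: "submodule N R M"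
  shows "Module.module R (quot_module M N)"
proof -
  interpret A: abelian_subgroup N M
    by (rule abelian_subgroupI3)
       (auto intro!: additive_subgroup.intro submodule.axioms(1)[OF N] M.abelian_group_axioms)
  note sm = quot_module_smult[OF N]
  have carrI: "N +>\<^bsub>M\<^esub> x \<in> carrier (quot_module M N)" if "x \<in> carrier M" for x
    using that by (auto simp: quot_module_def A_RCOSETS_def RCOSETS_def a_r_coset_def)
  have carrE: thesis
    if "X \<in> carrier (quot_module M N)" "\<And>x. x \<in> carrier M \<Longrightarrow> X = N +>\<^bsub>M\<^esub> x \<Longrightarrow> thesis"
    for X thesis
    using that by (auto simp: quot_module_def A_RCOSETS_def RCOSETS_def a_r_coset_def)
  have add: "(N +>\<^bsub>M\<^esub> x) \<oplus>\<^bsub>quot_module M N\<^esub> (N +>\<^bsub>M\<^esub> y) = N +>\<^bsub>M\<^esub> (x \<oplus>\<^bsub>M\<^esub> y)"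
    if "x \<in> carrier M" "y \<in> carrier M" for x y
    using A.a_rcos_sum[OF that] by (simp add: quot_module_def)
  have zero: "\<zero>\<^bsub>quot_module M N\<^esub> = N +>\<^bsub>M\<^esub> \<zero>\<^bsub>M\<^esub>"
    using A.a_subset M.a_coset_add_zero by (simp add: quot_module_def)
  note [simp del] = M.a_coset_add_zero
  show ?thesis
  proof (rule moduleI)
    show "abelian_group (quot_module M N)"
    proof (rule abelian_groupI)
      show "\<exists>Y\<in>carrier (quot_module M N). Y \<oplus>\<^bsub>quot_module M N\<^esub> X = \<zero>\<^bsub>quot_module M N\<^esub>"
        if X: "X \<in> carrier (quot_module M N)" for X
      proof -
        from X obtain x where x: "x \<in> carrier M" "X = N +>\<^bsub>M\<^esub> x"
          by (rule carrE)
        show ?thesis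
          by (rule bexI[of _ "N +>\<^bsub>M\<^esub> (\<ominus>\<^bsub>M\<^esub> x)"]) (simp_all add: x carrI add zero M.l_neg)
      qed
    qed (auto elim!: carrE simp: carrI add zero M.a_ac)
  qed (auto elim!: carrE simp: carrI add sm R.is_cring smult_l_distr smult_r_distr smult_assoc1)
qed

end

theory Submission
  imports Defs Complex_Main
begin

text \<open>
Passing from \<open>I\<close> to \<open>(I, u\<^sub>1, \<dots>, u\<^sub>r)\<close> one monomial at a time reduces the claim to a single
monomial \<open>u = x\<^sup>e\<close>, \<open>e \<noteq> 0\<close>, that is filter-regular on \<open>S/I\<close>, where \<open>I\<close> is a proper monomial ideal.
Let \<open>I'\<close> be the saturation of \<open>I\<close>, the set of all \<open>f\<close> that are multiplied into \<open>I\<close> by high powers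
of the variables. Because \<open>u\<close> avoids every associated prime other than \<open>\<mm>\<close>, it is a nonzerodivisor
modulo \<open>I'\<close> (\<open>regular_mod_sat\<close>). There are two cases.

If \<open>S/I\<close> has a nonzero element killed by \<open>\<mm>\<close>, then so has \<open>S/(I, u)\<close>: a monomial of least degree
in \<open>I' - I\<close> cannot lie in \<open>(I, u)\<close>, since dividing it by \<open>u\<close> would give one of smaller degree
(\<open>socle_mod_filter_regular\<close>). Both depths are then \<open>0\<close>, and Stanley's conjecture holds on both sides.

Otherwise \<open>I' = I\<close>, so that \<open>u\<close> is regular on \<open>S/I\<close>. Then both invariants drop by exactly one modulo
\<open>u\<close>, and the inequality between them is preserved.

For the depth this is Rees' theorem. With depth defined as a supremum over all regular sequences, the
point is to turn a regular sequence of length \<open>k\<close> on \<open>S/I\<close> into one of length \<open>k - 1\<close> on \<open>S/(I, u)\<close>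
(\<open>regseq_mod_regular_element\<close>). This is done by Kaplansky's exchange argument, which needs an element
of \<open>\<mm>\<close> that is regular modulo several ideals at once. Such an element comes from prime avoidance
and the finiteness of the set of maximal annihilators; that in turn rests on the Noetherian property
of \<open>S\<close>, which is obtained from Dickson's lemma and a monomial order (\<open>hilbert_basis\<close>).

For the Stanley depth, a Stanley decomposition of \<open>S/J\<close> with \<open>J\<close> monomial is the same as a partition
of the exponent vectors outside \<open>J\<close> into finitely many cones \<open>a + \<nat>\<^sup>Z\<close>. Let \<open>W\<close> be the support of
\<open>e\<close>. Since \<open>u\<close> is regular, membership of an exponent in \<open>I\<close> does not depend on its coordinates
in \<open>W\<close>. So the complement of \<open>I\<close> is a product \<open>A \<times> \<nat>\<^sup>W\<close>, and the complement of \<open>(I, u)\<close> is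
\<open>A \<times> {c \<in> \<nat>\<^sup>W. \<not> e \<le> c}\<close>. A partition of either set is cut down to \<open>A\<close> by setting the coordinates
in \<open>W\<close> to zero, and multiplied up again by a partition of the other factor. The staircase
\<open>{c. \<not> e \<le> c}\<close> splits into cones of dimension \<open>|W| - 1\<close>, and no cone outside \<open>(I, u)\<close> can be free
in all directions of \<open>W\<close>; comparing dimensions gives \<open>sdepth_mod_regular\<close>.
\<close>

section \<open>Ideals of a commutative ring\<close>

text \<open>A commutative ring is a module over itself, and its ideals are the submodules. The locale of modules is
instantiated fact by fact and not interpreted: its rule \<open>a * (b * x) = (a * b) * x\<close> for the
simplifier would clash with associativity oriented the other way.\<close>

abbreviation is_ideal :: "'a::comm_ring_1 set \<Rightarrow> bool" where
  "is_ideal \<equiv> Modules.module.subspace (*)"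

abbreviation gen :: "'a::comm_ring_1 set \<Rightarrow> 'a set" where
  "gen \<equiv> Modules.module.span (*)"

lemma module_mult: "Modules.module ((*) :: 'a::comm_ring_1 \<Rightarrow> 'a \<Rightarrow> 'a)"
  by standard (simp_all add: algebra_simps)

lemmas is_idealI = Modules.module.subspaceI[OF module_mult]
lemmas ideal_zero = Modules.module.subspace_0[OF module_mult]
lemmas ideal_add = Modules.module.subspace_add[OF module_mult]
lemmas ideal_diff = Modules.module.subspace_diff[OF module_mult]
lemmas ideal_mult = Modules.module.subspace_scale[OF module_mult]
lemmas ideal_sum = Modules.module.subspace_sum[OF module_mult]
lemmas gen_superset = Modules.module.span_superset[OF module_mult]
lemmas gen_base = Modules.module.span_base[OF module_mult]
lemmas gen_minimal = Modules.module.span_minimal[OF module_mult]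
lemmas gen_ideal = Modules.module.subspace_span[OF module_mult]
lemmas gen_mono = Modules.module.span_mono[OF module_mult]
lemmas gen_eq_self = Modules.module.span_eq_iff[OF module_mult]
lemmas gen_insert = Modules.module.span_breakdown_eq[OF module_mult]
lemmas gen_finite = Modules.module.span_finite[OF module_mult]

lemma gen_insert_ideal:
  assumes "is_ideal J"
  shows "x \<in> gen (insert a J) \<longleftrightarrow> (\<exists>k. x - k * a \<in> J)"
proof -
  have "gen J = J" using assms gen_eq_self by blast
  then show ?thesis by (simp add: gen_insert)
qed

lemma gen_gen_Un: "gen (gen A \<union> B) = gen (A \<union> B)"
proof
  show "gen (gen A \<union> B) \<subseteq> gen (A \<union> B)"
    by (intro gen_minimal gen_ideal Un_least gen_mono) (auto intro: gen_base)
  show "gen (A \<union> B) \<subseteq> gen (gen A \<union> B)"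
    by (intro gen_mono) (auto intro: gen_base)
qed

lemma gen_insert_Un: "gen (gen (insert a J) \<union> B) = gen (J \<union> insert a B)"
  by (simp add: gen_gen_Un)

lemma ideal_mult_right:
  "is_ideal J \<Longrightarrow> x \<in> J \<Longrightarrow> x * c \<in> J"
  using ideal_mult[of J x c] by (simp add: mult.commute)

text \<open>The ideal usually written \<open>(J : w)\<close>.\<close>

definition colon :: "'a::comm_ring_1 set \<Rightarrow> 'a \<Rightarrow> 'a set" where
  "colon J w = {a. a * w \<in> J}"

lemma colon_ideal:
  assumes "is_ideal J" shows "is_ideal (colon J w)"
  using assms
  by (intro is_idealI) (auto simp: colon_def distrib_right mult.assoc ideal_zero ideal_add ideal_mult)

definition prime_ideal :: "'a::comm_ring_1 set \<Rightarrow> bool" where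
  "prime_ideal P \<longleftrightarrow> is_ideal P \<and> 1 \<notin> P \<and> (\<forall>a b. a * b \<in> P \<longrightarrow> a \<in> P \<or> b \<in> P)"

lemma prime_ideal_prod:
  assumes "prime_ideal P" "finite A" "prod f A \<in> P"
  shows "\<exists>x\<in>A. f x \<in> P"
  using assms(2,3)
  by (induction A rule: finite_induct) (use assms(1) in \<open>auto simp: prime_ideal_def\<close>)

lemma prime_ideal_power:
  assumes "prime_ideal P" "x ^ k \<in> P" shows "x \<in> P"
  using assms(2) by (induction k) (use assms(1) in \<open>auto simp: prime_ideal_def\<close>)

text \<open>Induction on the number of primes. Leaving out one prime \<open>P\<close> at a time gives elements \<open>z\<^sub>P\<close> of \<open>M\<close>
outside all primes but possibly \<open>P\<close>. If there are at least two primes and every \<open>z\<^sub>P\<close> does lie in \<open>P\<close>, then \<open>z\<^sub>Q\<close> plus the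
product of all the others avoids every prime, because exactly one of the two summands lies in each of them.\<close>

lemma prime_avoidance:
  assumes "finite \<P>" "\<forall>P\<in>\<P>. prime_ideal P" "is_ideal M" "\<forall>P\<in>\<P>. \<not> M \<subseteq> P"
  shows "\<exists>z\<in>M. \<forall>P\<in>\<P>. z \<notin> P"
  using assms(1,2,4)
proof (induction "card \<P>" arbitrary: \<P> rule: less_induct)
  case less
  show ?case
  proof (cases "\<P> = {}")
    case True
    then show ?thesis using ideal_zero[OF assms(3)] by blast
  next
    case False
    have "\<forall>P\<in>\<P>. \<exists>z\<in>M. \<forall>Q\<in>\<P> - {P}. z \<notin> Q"
    proof
      fix P assume "P \<in> \<P>"
      with less.prems show "\<exists>z\<in>M. \<forall>Q\<in>\<P> - {P}. z \<notin> Q"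
        by (intro less.hyps card_Diff1_less) auto
    qed
    then obtain z where z: "\<And>P. P \<in> \<P> \<Longrightarrow> z P \<in> M"
      "\<And>P Q. P \<in> \<P> \<Longrightarrow> Q \<in> \<P> \<Longrightarrow> Q \<noteq> P \<Longrightarrow> z P \<notin> Q"
      by (metis DiffI singletonD)
    show ?thesis
    proof (cases "\<exists>P\<in>\<P>. z P \<notin> P")
      case True
      then show ?thesis using z by metis
    next
      case allin: False
      obtain P0 where P0: "P0 \<in> \<P>" using False by blast
      let ?A = "\<P> - {P0}"
      show ?thesis
      proof (cases "?A = {}")
        case True
        then have "\<P> = {P0}" using P0 by blast
        then show ?thesis using less.prems(3) by blast
      next
        case A: False
        define y where "y = prod z ?A"
        have yP: "y \<in> Q" if "Q \<in> ?A" for Q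
        proof -
          have "y = z Q * prod z (?A - {Q})"
            unfolding y_def using that less.prems(1) by (intro prod.remove) auto
          then show ?thesis
            using allin that less.prems(2) ideal_mult_right[of Q "z Q"] by (auto simp: prime_ideal_def)
        qed
        have yM: "y \<in> M"
        proof -
          obtain Q where Q: "Q \<in> ?A" using A by blast
          have "y = z Q * prod z (?A - {Q})"
            unfolding y_def using Q less.prems(1) by (intro prod.remove) auto
          then show ?thesis using Q z(1) ideal_mult_right[OF assms(3)] by auto
        qed
        have y0: "y \<notin> P0"
        proof
          assume "y \<in> P0"
          then obtain Q where "Q \<in> ?A" "z Q \<in> P0"
            using prime_ideal_prod[of P0 ?A z] less.prems(1,2) P0 unfolding y_def by auto
          then show False using z(2)[of Q P0] P0 by auto
        qed
        have "z P0 + y \<notin> Q" if "Q \<in> \<P>" for Q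
        proof
          assume a: "z P0 + y \<in> Q"
          have Qi: "is_ideal Q" using less.prems(2) that by (auto simp: prime_ideal_def)
          show False
          proof (cases "Q = P0")
            case True
            then have "z P0 \<in> Q" using allin P0 by blast
            then show False using ideal_diff[OF Qi a] y0 True by fastforce
          next
            case False
            then have "y \<in> Q" using yP that by blast
            then show False using ideal_diff[OF Qi a] z(2)[OF P0 that False] by fastforce
          qed
        qed
        moreover have "z P0 + y \<in> M" using ideal_add[OF assms(3) z(1)[OF P0] yM] .
        ultimately show ?thesis by blast
      qed
    qed
  qed
qed

section \<open>Maximal annihilators in Noetherian rings\<close>

text \<open>The parameter only names the type of the ring, so that the locale can be interpreted for polynomials.\<close>

locale noetherian_ring =
  fixes ring_type :: "'a::comm_ring_1 itself"
  assumes finitely_generated: "is_ideal (J :: 'a set) \<Longrightarrow> \<exists>F. finite F \<and> J = gen F"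
begin

lemma maximal_ideal_exists:
  fixes \<F> :: "'a set set"
  assumes "\<F> \<noteq> {}" "\<And>J. J \<in> \<F> \<Longrightarrow> is_ideal J"
  shows "\<exists>M\<in>\<F>. \<forall>J\<in>\<F>. M \<subseteq> J \<longrightarrow> J = M"
proof (rule subset_Zorn_nonempty[OF assms(1)])
  fix C assume C: "C \<noteq> {}" "subset.chain \<F> C"
  then have sub: "C \<subseteq> \<F>" by (simp add: subset_chain_def)
  have "is_ideal (\<Union>C)"
  proof (rule is_idealI)
    obtain X where "X \<in> C" using C(1) by blast
    then show "0 \<in> \<Union>C" using sub ideal_zero[OF assms(2)[of X]] by blast
    fix x y assume "x \<in> \<Union>C" "y \<in> \<Union>C"
    then obtain X Y where XY: "X \<in> C" "x \<in> X" "Y \<in> C" "y \<in> Y" by blast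
    then obtain Z where Z: "Z \<in> C" "x \<in> Z" "y \<in> Z" using C(2) unfolding subset_chain_def by blast
    then have "x + y \<in> Z" using sub by (intro ideal_add[OF assms(2)]) auto
    then show "x + y \<in> \<Union>C" using Z(1) by blast
  next
    fix c x assume "x \<in> \<Union>C"
    then obtain X where X: "X \<in> C" "x \<in> X" by blast
    then have "c * x \<in> X" using sub by (intro ideal_mult[OF assms(2)]) auto
    then show "c * x \<in> \<Union>C" using X(1) by blast
  qed
  then obtain F where F: "finite F" "\<Union>C = gen F" using finitely_generated by blast
  then obtain X where X: "X \<in> C" "F \<subseteq> X"
    using finite_subset_Union_chain[OF F(1) _ C] gen_superset[of F] by blast
  then have "gen F \<subseteq> X" using assms(2) sub by (intro gen_minimal) auto
  then have "\<Union>C = X" using F X(1) by blast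
  then show "\<Union>C \<in> \<F>" using X sub by auto
qed

text \<open>The maximal members among the annihilators of nonzero elements of the quotient by \<open>J\<close>. Their union is
the set of zero divisors modulo \<open>J\<close>.\<close>

definition max_annihilators :: "'a set \<Rightarrow> 'a set set" where
  "max_annihilators J =
    {P. \<exists>w. w \<notin> J \<and> P = colon J w \<and> (\<forall>w'. w' \<notin> J \<longrightarrow> P \<subseteq> colon J w' \<longrightarrow> colon J w' = P)}"

lemma max_annihilatorsE:
  assumes "P \<in> max_annihilators J"
  obtains w where "w \<notin> J" "P = colon J w"
    "\<forall>w'. w' \<notin> J \<longrightarrow> P \<subseteq> colon J w' \<longrightarrow> colon J w' = P"
  using assms unfolding max_annihilators_def mem_Collect_eq by (elim exE conjE)

lemma colon_subset_max_annihilator: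
  assumes J: "is_ideal J" and w: "w \<notin> J"
  shows "\<exists>P\<in>max_annihilators J. colon J w \<subseteq> P"
proof -
  let ?F = "{colon J w' | w'. w' \<notin> J \<and> colon J w \<subseteq> colon J w'}"
  have "\<exists>M\<in>?F. \<forall>K\<in>?F. M \<subseteq> K \<longrightarrow> K = M"
  proof (rule maximal_ideal_exists)
    show "?F \<noteq> {}" using w by blast
    show "is_ideal K" if "K \<in> ?F" for K using that colon_ideal[OF J] by blast
  qed
  then obtain M where "M \<in> ?F" "\<forall>K\<in>?F. M \<subseteq> K \<longrightarrow> K = M" by blast
  then obtain w' where w': "M = colon J w'" "w' \<notin> J" "colon J w \<subseteq> M" by blast
  have "M \<in> max_annihilators J"
    unfolding max_annihilators_def mem_Collect_eq
  proof (intro exI[of _ w'] conjI allI impI w')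
    fix v assume "v \<notin> J" "M \<subseteq> colon J v"
    then show "colon J v = M" using \<open>\<forall>K\<in>?F. M \<subseteq> K \<longrightarrow> K = M\<close> w'(3) by blast
  qed
  then show ?thesis using w'(3) by blast
qed

text \<open>If \<open>a * b\<close> kills \<open>w\<close> but \<open>b\<close> does not, then the annihilator of \<open>b * w\<close> contains that of
\<open>w\<close>, hence equals it by maximality, and it contains \<open>a\<close>.\<close>

lemma max_annihilator_prime:
  assumes J: "is_ideal J" and P: "P \<in> max_annihilators J"
  shows "prime_ideal P"
proof -
  obtain w where w: "w \<notin> J" "P = colon J w"
    "\<forall>w'. w' \<notin> J \<longrightarrow> P \<subseteq> colon J w' \<longrightarrow> colon J w' = P"
    using P by (rule max_annihilatorsE)
  show ?thesis unfolding prime_ideal_def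
  proof (intro conjI allI impI)
    show "is_ideal P" unfolding w(2) by (rule colon_ideal[OF J])
    show "1 \<notin> P" using w(1) unfolding w(2) by (simp add: colon_def)
    fix a b assume ab: "a * b \<in> P"
    show "a \<in> P \<or> b \<in> P"
    proof (cases "b * w \<in> J")
      case True
      then show ?thesis unfolding w(2) by (simp add: colon_def)
    next
      case False
      have "P \<subseteq> colon J (b * w)"
      proof
        fix x assume "x \<in> P"
        then have "b * (x * w) \<in> J" using w(2) ideal_mult[OF J, of _ b] by (simp add: colon_def)
        then show "x \<in> colon J (b * w)" by (simp add: colon_def mult.left_commute)
      qed
      then have "colon J (b * w) = P" using w(3)[rule_format, of "b * w"] False by blast
      then have "a \<in> P" using ab unfolding w(2) by (auto simp: colon_def mult.assoc)
      then show ?thesis ..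
    qed
  qed
qed

text \<open>Choose an element for each maximal annihilator. Finitely many of these elements generate the ideal
generated by all. An element that is a combination of the chosen finitely many is killed by the product of
their annihilators, so its annihilator, being prime, contains one of these and equals it by
maximality.\<close>

lemma finite_max_annihilators:
  assumes J: "is_ideal J"
  shows "finite (max_annihilators J)"
proof -
  have "\<forall>P\<in>max_annihilators J. \<exists>w. P = colon J w"
    by (blast elim: max_annihilatorsE)
  then obtain w where w: "\<And>P. P \<in> max_annihilators J \<Longrightarrow> P = colon J (w P)" by metis
  \<comment> \<open>A finite generating set can be taken among the elements \<open>w P\<close> themselves.\<close>
  have fg: "\<exists>G. finite G \<and> G \<subseteq> w ` max_annihilators J \<and> w ` max_annihilators J \<subseteq> gen G"
  proof -
    obtain F where F: "finite F" "gen (w ` max_annihilators J) = gen F"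
      using finitely_generated gen_ideal by metis
    have "\<forall>f\<in>F. \<exists>G. finite G \<and> G \<subseteq> w ` max_annihilators J \<and> f \<in> gen G"
    proof
      fix f assume "f \<in> F"
      then have "f \<in> gen (w ` max_annihilators J)" using F gen_base by blast
      then obtain t r where "finite t" "t \<subseteq> w ` max_annihilators J" "f = (\<Sum>a\<in>t. r a * a)"
        unfolding Modules.module.span_explicit[OF module_mult] by blast
      moreover from this have "f \<in> gen t" by (auto simp: gen_finite)
      ultimately show "\<exists>G. finite G \<and> G \<subseteq> w ` max_annihilators J \<and> f \<in> gen G" by blast
    qed
    then obtain G where G: "\<And>f. f \<in> F \<Longrightarrow> finite (G f) \<and> G f \<subseteq> w ` max_annihilators J \<and> f \<in> gen (G f)"
      by metis
    let ?G = "\<Union>f\<in>F. G f"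
    have "F \<subseteq> gen ?G" using G gen_mono[of "G _" ?G] by blast
    then have "gen F \<subseteq> gen ?G" by (intro gen_minimal gen_ideal)
    then have "w ` max_annihilators J \<subseteq> gen ?G" using F gen_superset by blast
    moreover have "finite ?G" "?G \<subseteq> w ` max_annihilators J" using F(1) G by auto
    ultimately show ?thesis by blast
  qed
  then obtain G where G: "finite G" "G \<subseteq> w ` max_annihilators J" "w ` max_annihilators J \<subseteq> gen G"
    by blast
  have "max_annihilators J \<subseteq> colon J ` G"
  proof
    fix P assume P: "P \<in> max_annihilators J"
    then have prP: "prime_ideal P" using max_annihilator_prime[OF J] by blast
    obtain r where r: "w P = (\<Sum>g\<in>G. r g * g)"
      using P G(3) unfolding gen_finite[OF G(1)] by blast
    have "\<exists>g\<in>G. colon J g \<subseteq> P"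
    proof (rule ccontr)
      assume "\<not> ?thesis"
      then have "\<forall>g\<in>G. \<exists>x. x \<in> colon J g \<and> x \<notin> P" by blast
      then obtain x where x: "\<And>g. g \<in> G \<Longrightarrow> x g \<in> colon J g \<and> x g \<notin> P" by metis
      let ?y = "prod x G"
      have "?y * (r g * g) \<in> J" if g: "g \<in> G" for g
      proof -
        have "?y = x g * prod x (G - {g})" using g G(1) by (rule prod.remove[rotated])
        then have "?y * (r g * g) = (prod x (G - {g}) * r g) * (x g * g)" by (simp add: mult_ac)
        then show ?thesis using x[OF g] ideal_mult[OF J] by (simp add: colon_def)
      qed
      then have "?y * w P \<in> J" unfolding r sum_distrib_left by (intro ideal_sum[OF J])
      then have "?y \<in> P" using w[OF P] by (auto simp: colon_def)
      then show False using prime_ideal_prod[OF prP G(1)] x by blast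
    qed
    then obtain g where g: "g \<in> G" "colon J g \<subseteq> P" by blast
    then obtain Q where Q: "Q \<in> max_annihilators J" "g = w Q" using G(2) by blast
    then have Qg: "Q = colon J g" using w by blast
    obtain v where v: "P = colon J v" "v \<notin> J" using P by (rule max_annihilatorsE)
    have "colon J v = Q"
      using Q(1) by (rule max_annihilatorsE) (use v g(2) Qg in simp)
    then show "P \<in> colon J ` G" using g(1) Qg v(1) by blast
  qed
  then show ?thesis using G(1) finite_surj by blast
qed

end

section \<open>Regular sequences modulo an ideal\<close>

definition regular_mod :: "'a::comm_ring_1 set \<Rightarrow> 'a \<Rightarrow> bool" where
  "regular_mod J a \<longleftrightarrow> (\<forall>x. a * x \<in> J \<longrightarrow> x \<in> J)"

text \<open>The obstruction to finding a regular element in \<open>M\<close>. For the graded maximal ideal \<open>M\<close> of \<open>S\<close> it says that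
the quotient by \<open>J\<close> has nonzero socle.\<close>

definition has_socle :: "'a::comm_ring_1 set \<Rightarrow> 'a set \<Rightarrow> bool" where
  "has_socle M J \<longleftrightarrow> (\<exists>w. w \<notin> J \<and> (\<forall>a\<in>M. a * w \<in> J))"

fun regseq :: "'a::comm_ring_1 set \<Rightarrow> 'a list \<Rightarrow> bool" where
  "regseq J [] \<longleftrightarrow> True"
| "regseq J (a # as) \<longleftrightarrow> regular_mod J a \<and> regseq (gen (insert a J)) as"

lemma regular_no_socle: "a \<in> M \<Longrightarrow> regular_mod J a \<Longrightarrow> \<not> has_socle M J"
  by (auto simp: regular_mod_def has_socle_def)

text \<open>The case of length one in the theorem that maximal regular sequences have equal length. If \<open>M\<close>
kills \<open>w\<close> modulo \<open>(J, a)\<close>, then \<open>b * w = a * v\<close> modulo \<open>J\<close> for some \<open>v\<close>, and this \<open>v\<close> is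
killed by \<open>M\<close> modulo \<open>(J, b)\<close>.\<close>

lemma socle_exchange:
  assumes J: "is_ideal J" and ab: "a \<in> M" "b \<in> M" "regular_mod J a" "regular_mod J b"
    and s: "has_socle M (gen (insert a J))"
  shows "has_socle M (gen (insert b J))"
proof -
  note ins = gen_insert_ideal[OF J]
  obtain w where w: "w \<notin> gen (insert a J)" "\<And>c. c \<in> M \<Longrightarrow> c * w \<in> gen (insert a J)"
    using s by (auto simp: has_socle_def)
  obtain v where v: "b * w - v * a \<in> J" using w(2)[OF ab(2)] ins by blast
  have "v \<notin> gen (insert b J)"
  proof
    assume "v \<in> gen (insert b J)"
    then obtain k where k: "v - k * b \<in> J" using ins by blast
    have "(b * w - v * a) + (v - k * b) * a \<in> J"
      using ideal_add[OF J v ideal_mult_right[OF J k]] .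
    then have "b * (w - k * a) \<in> J" by (simp add: algebra_simps)
    then have "w - k * a \<in> J" using ab(4) by (auto simp: regular_mod_def)
    then show False using w(1) ins by blast
  qed
  moreover have "c * v \<in> gen (insert b J)" if c: "c \<in> M" for c
  proof -
    obtain t where t: "c * w - t * a \<in> J" using w(2)[OF c] ins by blast
    have "b * (c * w - t * a) - c * (b * w - v * a) \<in> J"
      using ideal_diff[OF J ideal_mult[OF J t] ideal_mult[OF J v]] .
    then have "a * (c * v - t * b) \<in> J" by (simp add: algebra_simps)
    then have "c * v - t * b \<in> J" using ab(3) by (auto simp: regular_mod_def)
    then show ?thesis using ins by blast
  qed
  ultimately show ?thesis by (auto simp: has_socle_def)
qed

text \<open>One half of permuting a regular sequence \<open>a, z\<close>. If \<open>a * s = t * z\<close> modulo \<open>J\<close>,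
then \<open>t\<close> is a multiple \<open>k * a\<close> modulo \<open>J\<close> by regularity of \<open>z\<close>, and cancelling \<open>a\<close> leaves
\<open>s = k * z\<close>.\<close>

lemma regular_swap:
  assumes J: "is_ideal J" and "regular_mod J a" "regular_mod (gen (insert a J)) z"
  shows "regular_mod (gen (insert z J)) a"
  unfolding regular_mod_def
proof (intro allI impI)
  note ins = gen_insert_ideal[OF J]
  fix s assume "a * s \<in> gen (insert z J)"
  then obtain t where t: "a * s - t * z \<in> J" using ins by blast
  have "(-1) * (a * s - t * z) \<in> J" using ideal_mult[OF J t] .
  then have "z * t - s * a \<in> J" by (simp add: algebra_simps)
  then have "z * t \<in> gen (insert a J)" using ins by blast
  then have "t \<in> gen (insert a J)" using assms(3) by (auto simp: regular_mod_def)
  then obtain k where k: "t - k * a \<in> J" using ins by blast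
  have "(a * s - t * z) + (t - k * a) * z \<in> J"
    using ideal_add[OF J t ideal_mult_right[OF J k]] .
  then have "a * (s - k * z) \<in> J" by (simp add: algebra_simps)
  then have "s - k * z \<in> J" using assms(2) by (auto simp: regular_mod_def)
  then show "s \<in> gen (insert z J)" using ins by blast
qed

lemma gen_insert_commute: "gen (insert a (gen (insert b J))) = gen (insert b (gen (insert a J)))"
  using gen_gen_Un[of "insert b J" "{a}"] gen_gen_Un[of "insert a J" "{b}"]
  by (simp add: insert_commute)

context noetherian_ring begin

text \<open>An ideal without socle has no maximal annihilator containing \<open>M\<close>, so prime avoidance applies to
the maximal annihilators of all the given ideals at once.\<close>

lemma common_regular_element:
  fixes M :: "'a set"
  assumes "finite \<J>" "is_ideal M" "\<And>J. J \<in> \<J> \<Longrightarrow> is_ideal J" "\<And>J. J \<in> \<J> \<Longrightarrow> \<not> has_socle M J"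
  shows "\<exists>z\<in>M. \<forall>J\<in>\<J>. regular_mod J z"
proof -
  have "\<not> M \<subseteq> P" if "J \<in> \<J>" "P \<in> max_annihilators J" for J P
  proof
    assume "M \<subseteq> P"
    moreover obtain w where "w \<notin> J" "P = colon J w"
      using \<open>P \<in> max_annihilators J\<close> by (rule max_annihilatorsE)
    ultimately have "has_socle M J" by (auto simp: has_socle_def colon_def)
    then show False using assms(4) that by blast
  qed
  then have "\<exists>z\<in>M. \<forall>P\<in>(\<Union>J\<in>\<J>. max_annihilators J). z \<notin> P"
    using assms(1-3) by (intro prime_avoidance) (auto intro: finite_max_annihilators max_annihilator_prime)
  then obtain z where z: "z \<in> M" "\<And>J P. J \<in> \<J> \<Longrightarrow> P \<in> max_annihilators J \<Longrightarrow> z \<notin> P" by blast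
  have "regular_mod J z" if J: "J \<in> \<J>" for J
    unfolding regular_mod_def
  proof (intro allI impI, rule ccontr)
    fix x assume x: "z * x \<in> J" "x \<notin> J"
    then obtain P where "P \<in> max_annihilators J" "colon J x \<subseteq> P"
      using colon_subset_max_annihilator[OF assms(3)[OF J]] by blast
    then show False using z(2)[OF J] x(1) by (auto simp: colon_def)
  qed
  then show ?thesis using z(1) by blast
qed

text \<open>Rees' theorem in the form needed here, by Kaplansky's exchange argument. For a sequence \<open>a, a\<^sub>2, \<dots>\<close> of
length at least two pick \<open>z \<in> M\<close> that is regular modulo \<open>J\<close>, \<open>(J, a)\<close> and \<open>(J, u)\<close>; modulo
\<open>(J, u)\<close> there is no socle by \<open>socle_exchange\<close>. The induction hypothesis replaces \<open>a\<^sub>2, \<dots>\<close> by a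
sequence shorter by one that is regular modulo \<open>(J, a, z)\<close>. Prefixing \<open>a\<close> gives a regular sequence modulo
\<open>(J, z)\<close>, and a second use of the hypothesis, now for \<open>(J, z)\<close> and \<open>u\<close>, gives one modulo
\<open>(J, z, u)\<close>, to which \<open>z\<close> is prefixed.\<close>

theorem regseq_mod_regular_element:
  fixes M :: "'a set"
  assumes M: "is_ideal M"
  shows "is_ideal J \<Longrightarrow> regseq J as \<Longrightarrow> set as \<subseteq> M \<Longrightarrow> as \<noteq> [] \<Longrightarrow> u \<in> M \<Longrightarrow> regular_mod J u \<Longrightarrow>
    \<exists>bs. set bs \<subseteq> M \<and> length bs = length as - 1 \<and> regseq (gen (insert u J)) bs"
proof (induction "length as" arbitrary: J as u rule: less_induct)
  case less
  note J = \<open>is_ideal J\<close>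
  obtain a as' where as: "as = a # as'" using \<open>as \<noteq> []\<close> by (cases as) auto
  have a: "a \<in> M" "regular_mod J a" and as': "regseq (gen (insert a J)) as'" "set as' \<subseteq> M"
    using less.prems as by auto
  show ?case
  proof (cases as')
    case Nil
    then show ?thesis using as by (intro exI[of _ "[]"]) simp
  next
    case (Cons a2 as'')
    have "a2 \<in> M" "regular_mod (gen (insert a J)) a2" using as' Cons by auto
    then have n1: "\<not> has_socle M (gen (insert a J))" by (rule regular_no_socle)
    then have n2: "\<not> has_socle M (gen (insert u J))"
      using socle_exchange[OF J \<open>u \<in> M\<close> a(1) \<open>regular_mod J u\<close> a(2)] by blast
    have n3: "\<not> has_socle M J" by (rule regular_no_socle[OF a])
    have "\<exists>z\<in>M. \<forall>K\<in>{J, gen (insert a J), gen (insert u J)}. regular_mod K z"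
      using n1 n2 n3 J by (intro common_regular_element M) (auto simp: gen_ideal)
    then obtain z where z: "z \<in> M" "regular_mod J z" "regular_mod (gen (insert a J)) z"
      "regular_mod (gen (insert u J)) z" by blast
    have "\<exists>bs. set bs \<subseteq> M \<and> length bs = length as' - 1 \<and> regseq (gen (insert z (gen (insert a J)))) bs"
      by (rule less.hyps) (use as as' Cons z in \<open>auto simp: gen_ideal\<close>)
    then obtain bs where bs: "set bs \<subseteq> M" "length bs = length as' - 1"
      "regseq (gen (insert z (gen (insert a J)))) bs" by blast
    have az: "regular_mod (gen (insert z J)) a" by (rule regular_swap[OF J a(2) z(3)])
    have uz: "regular_mod (gen (insert z J)) u" by (rule regular_swap[OF J \<open>regular_mod J u\<close> z(4)])
    have "regseq (gen (insert z J)) (a # bs)"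
      using az bs(3) by (simp add: gen_insert_commute[of z a])
    then have "\<exists>cs. set cs \<subseteq> M \<and> length cs = length (a # bs) - 1 \<and>
        regseq (gen (insert u (gen (insert z J)))) cs"
      using bs a uz as Cons \<open>u \<in> M\<close> by (intro less.hyps) (auto simp: gen_ideal)
    then obtain cs where cs: "set cs \<subseteq> M" "length cs = length bs"
      "regseq (gen (insert u (gen (insert z J)))) cs" by auto
    have "regseq (gen (insert u J)) (z # cs)"
      using z(4) cs(3) by (simp add: gen_insert_commute[of u z])
    then show ?thesis
      using z(1) cs bs(2) as Cons by (intro exI[of _ "z # cs"]) auto
  qed
qed

end

section \<open>Hilbert's basis theorem\<close>

definition exp_le :: "('n \<Rightarrow>\<^sub>0 nat) \<Rightarrow> ('n \<Rightarrow>\<^sub>0 nat) \<Rightarrow> bool" where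
  "exp_le a b \<longleftrightarrow> (\<forall>i. Poly_Mapping.lookup a i \<le> Poly_Mapping.lookup b i)"

lemma exp_le_refl [simp]: "exp_le a a"
  by (simp add: exp_le_def)

lemma exp_le_trans: "exp_le a b \<Longrightarrow> exp_le b c \<Longrightarrow> exp_le a c"
  unfolding exp_le_def by (blast intro: order_trans)

lemma exp_le_add [simp]: "exp_le a (a + c)" "exp_le a (c + a)"
  by (simp_all add: exp_le_def lookup_add)

lemma exp_leE:
  assumes "exp_le a b" obtains c where "b = a + c"
proof
  show "b = a + (b - a)"
    using assms by (intro poly_mapping_eqI) (simp add: exp_le_def lookup_add lookup_minus)
qed

definition exp_deg :: "('n::finite \<Rightarrow>\<^sub>0 nat) \<Rightarrow> nat" where
  "exp_deg a = (\<Sum>i\<in>UNIV. Poly_Mapping.lookup a i)"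

lemma exp_deg_add: "exp_deg (a + b) = exp_deg a + exp_deg b"
  by (simp add: exp_deg_def lookup_add sum.distrib)

lemma exp_deg_eq_0: "exp_deg a = 0 \<longleftrightarrow> a = 0"
  by (auto simp: exp_deg_def intro: poly_mapping_eqI)

lemma nat_mono_subseq:
  fixes g :: "nat \<Rightarrow> nat"
  shows "\<exists>s :: nat \<Rightarrow> nat. strict_mono s \<and> mono (g \<circ> s)"
proof -
  obtain s :: "nat \<Rightarrow> nat" where s: "strict_mono s" "monoseq (\<lambda>n. g (s n))" using seq_monosub by blast
  show ?thesis
  proof (cases "\<forall>m. \<forall>n\<ge>m. g (s m) \<le> g (s n)")
    case True
    then show ?thesis using s by (intro exI[of _ s]) (auto simp: mono_def)
  next
    case False
    then have dec: "\<And>m n. m \<le> n \<Longrightarrow> g (s n) \<le> g (s m)" using s(2) unfolding monoseq_def by blast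
    define N where "N = (ARG_MIN (\<lambda>n. g (s n)) n. True)"
    have N: "g (s N) \<le> g (s n)" for n
      unfolding N_def by (rule arg_min_nat_le) simp
    have const: "g (s (N + n)) = g (s N)" for n
      using dec[of N "N + n"] N[of "N + n"] by simp
    have "strict_mono (\<lambda>n. s (N + n))" using s(1) by (auto simp: strict_mono_def)
    then show ?thesis
      by (intro exI[of _ "\<lambda>n. s (N + n)"]) (simp add: mono_def const)
  qed
qed

lemma exp_mono_subseq:
  fixes f :: "nat \<Rightarrow> 'n::finite \<Rightarrow>\<^sub>0 nat"
  shows "\<exists>r :: nat \<Rightarrow> nat. strict_mono r \<and> (\<forall>v\<in>V. mono (\<lambda>i. Poly_Mapping.lookup (f (r i)) v))"
proof -
  have "finite V" by simp
  then show ?thesis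
  proof (induction V rule: finite_induct)
    case empty
    then show ?case by (intro exI[of _ id]) (auto simp: strict_mono_def)
  next
    case (insert v V)
    then obtain r :: "nat \<Rightarrow> nat" where r: "strict_mono r" "\<forall>v\<in>V. mono (\<lambda>i. Poly_Mapping.lookup (f (r i)) v)" by blast
    obtain s :: "nat \<Rightarrow> nat" where s: "strict_mono s" "mono ((\<lambda>i. Poly_Mapping.lookup (f (r i)) v) \<circ> s)"
      using nat_mono_subseq by blast
    have "mono s" using s(1) by (rule strict_mono_mono)
    then have "\<forall>w\<in>insert v V. mono (\<lambda>i. Poly_Mapping.lookup (f ((r \<circ> s) i)) w)"
      using r(2) s(2) by (auto simp: mono_def)
    moreover have "strict_mono (r \<circ> s)" using r(1) s(1) by (rule strict_mono_o)
    ultimately show ?case by blast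
  qed
qed

text \<open>\<open>B\<close> consists of the minimal elements of \<open>A\<close>. It is finite because every sequence of exponent vectors
has a subsequence that increases in each coordinate, whereas distinct minimal elements are incomparable.\<close>

lemma dickson:
  fixes A :: "('n::finite \<Rightarrow>\<^sub>0 nat) set"
  shows "\<exists>B. finite B \<and> B \<subseteq> A \<and> (\<forall>a\<in>A. \<exists>b\<in>B. exp_le b a)"
proof -
  define B where "B = {a\<in>A. \<forall>b\<in>A. exp_le b a \<longrightarrow> b = a}"
  have "\<exists>b\<in>B. exp_le b a" if "a \<in> A" for a
    using that
  proof (induction "exp_deg a" arbitrary: a rule: less_induct)
    case less
    show ?case
    proof (cases "a \<in> B")
      case False
      then obtain b where b: "b \<in> A" "exp_le b a" "b \<noteq> a" using less.prems by (auto simp: B_def)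
      then obtain c where c: "a = b + c" by (auto elim: exp_leE)
      then have "exp_deg b < exp_deg a"
        using b(3) exp_deg_eq_0[of c] by (cases "c = 0") (auto simp: exp_deg_add)
      then show ?thesis using less.hyps[of b] b exp_le_trans by blast
    qed (blast intro: exp_le_refl)
  qed
  moreover have "finite B"
  proof (rule ccontr)
    assume "infinite B"
    then obtain f :: "nat \<Rightarrow> 'n \<Rightarrow>\<^sub>0 nat" where f: "inj f" "range f \<subseteq> B"
      by (metis infinite_countable_subset)
    obtain r :: "nat \<Rightarrow> nat" where r: "strict_mono r" "\<forall>v\<in>UNIV. mono (\<lambda>i. Poly_Mapping.lookup (f (r i)) v)"
      using exp_mono_subseq by blast
    have "exp_le (f (r 0)) (f (r 1))" using r(2) by (auto simp: exp_le_def mono_def)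
    moreover have "f (r 0) \<in> B" "f (r 1) \<in> B" using f(2) by auto
    ultimately have "f (r 0) = f (r 1)" unfolding B_def by blast
    then show False using f(1) r(1) by (auto dest!: injD simp: strict_mono_eq)
  qed
  ultimately show ?thesis by (intro exI[of _ B]) (auto simp: B_def)
qed

text \<open>The lexicographic order for an enumeration of the variables. It is taken on lists, where it is known to
be well-founded.\<close>

lemma monomial_order_exists:
  "\<exists>R :: ('n::finite \<Rightarrow>\<^sub>0 nat) rel.
    wf R \<and> total R \<and> trans R \<and> (\<forall>a b c. (a, b) \<in> R \<longrightarrow> (c + a, c + b) \<in> R)"
proof -
  obtain vs :: "'n list" where vs: "set vs = UNIV" using finite_list[OF finite_UNIV] by blast
  define code where "code = (\<lambda>a :: 'n \<Rightarrow>\<^sub>0 nat. map (Poly_Mapping.lookup a) vs)"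
  define R where "R = inv_image (lenlex less_than) code"
  have inj: "inj code"
  proof (rule injI)
    fix a b assume "code a = code b"
    then show "a = b" using vs by (auto simp: code_def intro: poly_mapping_eqI)
  qed
  have "total (lenlex less_than)" by (rule total_lenlex) (auto simp: total_on_def)
  then have "total R" using inj unfolding R_def total_on_def by (auto simp: inj_eq)
  moreover have "wf R" unfolding R_def by (intro wf_inv_image wf_lenlex) simp
  moreover have "trans R" unfolding R_def by (intro trans_inv_image lenlex_transI) simp
  moreover have "(map (Poly_Mapping.lookup (c + a)) xs, map (Poly_Mapping.lookup (c + b)) xs) \<in> lenlex less_than"
    if "(map (Poly_Mapping.lookup a) xs, map (Poly_Mapping.lookup b) xs) \<in> lenlex less_than"
    for a b c :: "'n \<Rightarrow>\<^sub>0 nat" and xs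
    using that by (induction xs) (auto simp: Cons_lenlex_iff lookup_add)
  then have "\<forall>a b c. (a, b) \<in> R \<longrightarrow> (c + a, c + b) \<in> R" by (simp add: R_def code_def)
  ultimately show ?thesis by blast
qed

lemma poly_sum_terms:
  "f = (\<Sum>a\<in>Poly_Mapping.keys f. Poly_Mapping.single a (Poly_Mapping.lookup f a))"
  by (rule poly_mapping_eqI) (auto simp: lookup_sum lookup_single when_def in_keys_iff)

lemma single_times:
  fixes f :: "'a::monoid_add \<Rightarrow>\<^sub>0 'b::semiring_0"
  shows "Poly_Mapping.single c k * f =
    (\<Sum>a\<in>Poly_Mapping.keys f. Poly_Mapping.single (c + a) (k * Poly_Mapping.lookup f a))"
proof -
  have "Poly_Mapping.single c k * f =
      (\<Sum>a\<in>Poly_Mapping.keys f. Poly_Mapping.single c k * Poly_Mapping.single a (Poly_Mapping.lookup f a))"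
    by (subst poly_sum_terms[of f]) (simp only: sum_distrib_left)
  then show ?thesis by (simp add: mult_single)
qed

lemma lookup_single_times:
  fixes f :: "'a::cancel_comm_monoid_add \<Rightarrow>\<^sub>0 'b::semiring_0"
  shows "Poly_Mapping.lookup (Poly_Mapping.single c k * f) (c + a) = k * Poly_Mapping.lookup f a"
  by (auto simp: single_times lookup_sum lookup_single when_def in_keys_iff)

lemma keys_single_times:
  fixes f :: "'a::cancel_comm_monoid_add \<Rightarrow>\<^sub>0 'b::semiring_0"
  shows "Poly_Mapping.keys (Poly_Mapping.single c k * f) \<subseteq> (\<lambda>a. c + a) ` Poly_Mapping.keys f"
  using keys_mult[of "Poly_Mapping.single c k" f] by (auto split: if_splits)

text \<open>By Dickson's lemma finitely many leading exponents of elements of \<open>J\<close> lie below all others. The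
corresponding polynomials generate \<open>J\<close>: subtracting a monomial multiple of one of them cancels the leading
term of any given element, and this process ends because the monomial order is well-founded.\<close>

theorem hilbert_basis:
  fixes J :: "('n::finite, 'k::field) mpol set"
  assumes J: "is_ideal J"
  shows "\<exists>F. finite F \<and> J = gen F"
proof -
  obtain R :: "('n \<Rightarrow>\<^sub>0 nat) rel" where R: "wf R" "total R" "trans R"
    "\<And>a b c. (a, b) \<in> R \<Longrightarrow> (c + a, c + b) \<in> R"
    using monomial_order_exists[where 'n = 'n] by (elim exE conjE) (simp only:)
  define lead where "lead = (\<lambda>(f :: ('n, 'k) mpol) a. a \<in> Poly_Mapping.keys f \<and>
    (\<forall>b\<in>Poly_Mapping.keys f. b = a \<or> (b, a) \<in> R))"
  have max: "\<exists>a\<in>A. \<forall>b\<in>A. b = a \<or> (b, a) \<in> R" if "finite A" "A \<noteq> {}" for A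
    using that
  proof (induction A rule: finite_ne_induct)
    case (insert x F)
    then obtain a where a: "a \<in> F" "\<forall>b\<in>F. b = a \<or> (b, a) \<in> R" by blast
    consider "x = a" | "(x, a) \<in> R" | "(a, x) \<in> R" using R(2) by (auto simp: total_on_def)
    then show ?case
    proof cases
      case 3
      then show ?thesis using a transD[OF R(3)] by (intro bexI[of _ x]) auto
    qed (use a in auto)
  qed simp
  have lead_ex: "\<exists>a. lead f a" if "f \<noteq> 0" for f
    using max[of "Poly_Mapping.keys f"] that by (auto simp: lead_def)
  obtain B where B: "finite B" "B \<subseteq> {a. \<exists>f\<in>J. lead f a}"
    "\<And>a f. f \<in> J \<Longrightarrow> lead f a \<Longrightarrow> \<exists>b\<in>B. exp_le b a"
    using dickson[of "{a. \<exists>f\<in>J. lead f a}"] by blast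
  obtain p where p: "\<And>b. b \<in> B \<Longrightarrow> p b \<in> J \<and> lead (p b) b" proof -
    have "\<forall>b\<in>B. \<exists>f. f \<in> J \<and> lead f b" using B(2) by blast
    then show thesis using that by (rule bchoice[THEN exE]) blast
  qed
  have "g \<in> gen (p ` B)" if "g \<in> J" "lead g a" for g a
    using R(1) that
  proof (induction a arbitrary: g rule: wf_induct_rule)
    case (less a)
    obtain b where b: "b \<in> B" "exp_le b a" using B(3)[OF less.prems] by blast
    obtain c where c: "a = c + b" using exp_leE[OF b(2)] by (metis add.commute)
    define q where "q = Poly_Mapping.single c (Poly_Mapping.lookup g a / Poly_Mapping.lookup (p b) b)"
    have lb: "lead (p b) b" "p b \<in> J" using p b by auto
    have pb: "p b \<in> gen (p ` B)" using b by (intro gen_base) auto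
    define h where "h = g - q * p b"
    have hJ: "h \<in> J" unfolding h_def by (intro ideal_diff[OF J] ideal_mult[OF J] less.prems lb)
    have "Poly_Mapping.lookup (q * p b) a = Poly_Mapping.lookup g a"
      using lb(1) unfolding q_def c lookup_single_times by (simp add: lead_def in_keys_iff)
    then have h0: "Poly_Mapping.lookup h a = 0" by (simp add: h_def lookup_minus)
    have hk: "(x, a) \<in> R" if x: "x \<in> Poly_Mapping.keys h" for x
    proof -
      have "x \<in> Poly_Mapping.keys g \<or> x \<in> Poly_Mapping.keys (q * p b)"
        using x by (auto simp: h_def in_keys_iff lookup_minus)
      then have "x = a \<or> (x, a) \<in> R"
      proof
        assume "x \<in> Poly_Mapping.keys g"
        then show ?thesis using less.prems(2) by (auto simp: lead_def)
      next
        assume "x \<in> Poly_Mapping.keys (q * p b)"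
        then obtain y where "y \<in> Poly_Mapping.keys (p b)" "x = c + y"
          using keys_single_times unfolding q_def by blast
        moreover have "y = b \<or> (y, b) \<in> R" using calculation(1) lb(1) by (auto simp: lead_def)
        ultimately show ?thesis using R(4) unfolding c by blast
      qed
      moreover have "x \<noteq> a" using x h0 by (auto simp: in_keys_iff)
      ultimately show ?thesis by blast
    qed
    have "h \<in> gen (p ` B)"
    proof (cases "h = 0")
      case True
      then show ?thesis by (simp add: ideal_zero[OF gen_ideal])
    next
      case False
      then obtain d where "lead h d" using lead_ex by blast
      moreover from this have "(d, a) \<in> R" using hk by (auto simp: lead_def)
      ultimately show ?thesis using less.IH[OF _ hJ] by blast
    qed
    moreover have "g = h + q * p b" by (simp add: h_def)
    ultimately show ?case
      using ideal_add[OF gen_ideal _ ideal_mult[OF gen_ideal pb]] by simp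
  qed
  then have "J \<subseteq> gen (p ` B)" using lead_ex ideal_zero[OF gen_ideal] by (metis subsetI)
  moreover have "gen (p ` B) \<subseteq> J" using p by (intro gen_minimal J) auto
  ultimately show ?thesis using B(1) by blast
qed

interpretation mpol: noetherian_ring "TYPE(('n::finite, 'k::field) mpol)"
  by standard (rule hilbert_basis)

section \<open>Saturation and filter-regular elements\<close>

text \<open>For finite \<open>X\<close> this is the saturation of \<open>J\<close> by the ideal that \<open>X\<close> generates. Bounding only the
powers of the generators avoids powers of that ideal.\<close>

definition sat :: "'a::comm_ring_1 set \<Rightarrow> 'a set \<Rightarrow> 'a set" where
  "sat X J = {f. \<exists>k. \<forall>x\<in>X. x ^ k * f \<in> J}"

lemma power_mult_ideal_mono:
  assumes "is_ideal J" "x ^ k * f \<in> J" "k \<le> l"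
  shows "x ^ l * f \<in> J"
proof -
  have "x ^ l * f = x ^ (l - k) * (x ^ k * f)"
    using assms(3) by (simp add: mult.assoc[symmetric] power_add[symmetric])
  then show ?thesis using ideal_mult[OF assms(1,2)] by simp
qed

lemma sat_ideal:
  assumes J: "is_ideal J" shows "is_ideal (sat X J)"
proof (rule is_idealI)
  show "0 \<in> sat X J" by (simp add: sat_def ideal_zero[OF J])
  fix f assume "f \<in> sat X J"
  then obtain k where k: "\<And>x. x \<in> X \<Longrightarrow> x ^ k * f \<in> J" by (auto simp: sat_def)
  show "c * f \<in> sat X J" for c
    using ideal_mult[OF J k, of _ c] by (auto simp: sat_def mult.left_commute)
  fix g assume "g \<in> sat X J"
  then obtain l where l: "\<And>x. x \<in> X \<Longrightarrow> x ^ l * g \<in> J" by (auto simp: sat_def)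
  have "x ^ (k + l) * (f + g) \<in> J" if x: "x \<in> X" for x
    unfolding distrib_left
    by (intro ideal_add[OF J] power_mult_ideal_mono[OF J k[OF x]] power_mult_ideal_mono[OF J l[OF x]]) auto
  then show "f + g \<in> sat X J" by (auto simp: sat_def)
qed

lemma subset_sat: "is_ideal J \<Longrightarrow> J \<subseteq> sat X J"
  by (auto simp: sat_def intro!: ideal_mult)

lemma sat_mono: "J \<subseteq> J' \<Longrightarrow> sat X J \<subseteq> sat X J'"
  by (auto simp: sat_def)

lemma sat_closed:
  assumes J: "is_ideal J" and X: "finite X" and f: "\<And>x. x \<in> X \<Longrightarrow> x * f \<in> sat X J"
  shows "f \<in> sat X J"
proof -
  have "\<forall>x\<in>X. \<exists>k. x ^ k * f \<in> J"
  proof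
    fix x assume x: "x \<in> X"
    then obtain k where "\<forall>y\<in>X. y ^ k * (x * f) \<in> J" using f[OF x] by (auto simp: sat_def)
    then have "x ^ Suc k * f \<in> J" using x by (simp only: power_Suc2 mult.assoc)
    then show "\<exists>k. x ^ k * f \<in> J" by blast
  qed
  then obtain k where k: "\<And>x. x \<in> X \<Longrightarrow> x ^ k x * f \<in> J" by metis
  have "x ^ sum k X * f \<in> J" if x: "x \<in> X" for x
    using power_mult_ideal_mono[OF J k[OF x]] member_le_sum[OF x _ X, of k] by simp
  then show ?thesis by (auto simp: sat_def)
qed

text \<open>Multiply \<open>w\<close>, one \<open>x\<close> after the other, by the largest power of \<open>x\<close> that does not bring it into
\<open>J\<close>.\<close>

lemma socle_of_sat:
  assumes J: "is_ideal J" and X: "finite X" and w: "w \<in> sat X J" "w \<notin> J"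
  shows "has_socle X J"
proof -
  have "\<exists>g. g * w \<notin> J \<and> (\<forall>x\<in>Y. x * (g * w) \<in> J)" if "finite Y" "Y \<subseteq> X" for Y
    using that
  proof (induction Y rule: finite_induct)
    case empty
    then show ?case using w by (intro exI[of _ 1]) simp
  next
    case (insert x Y)
    then obtain g where g: "g * w \<notin> J" "\<And>y. y \<in> Y \<Longrightarrow> y * (g * w) \<in> J" by auto
    obtain k where "x ^ k * w \<in> J" using w(1) insert.prems by (auto simp: sat_def)
    then have ex: "x ^ k * (g * w) \<in> J" using ideal_mult[OF J, of _ g] by (simp add: mult.left_commute)
    define m where "m = (LEAST k. x ^ k * (g * w) \<in> J)"
    have m: "x ^ m * (g * w) \<in> J" unfolding m_def using ex by (rule LeastI)
    then have "m \<noteq> 0" using g(1) by (intro notI) simp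
    then obtain l where l: "m = Suc l" by (cases m) auto
    have "x ^ l * (g * w) \<notin> J"
      using not_less_Least[of l "\<lambda>k. x ^ k * (g * w) \<in> J"] unfolding m_def[symmetric] l by simp
    moreover have "x * (x ^ l * g * w) \<in> J" using m by (simp add: l mult.assoc)
    moreover have "y * (x ^ l * g * w) \<in> J" if "y \<in> Y" for y
      using ideal_mult[OF J g(2)[OF that], of "x ^ l"] by (simp add: mult_ac)
    ultimately show ?case by (intro exI[of _ "x ^ l * g"]) (auto simp: mult.assoc)
  qed
  from this[OF X] obtain g where "g * w \<notin> J" "\<forall>x\<in>X. x * (g * w) \<in> J" by blast
  then show ?thesis unfolding has_socle_def by blast
qed

text \<open>The associated primes of the quotient by \<open>J\<close>. Primes being proper, the witness \<open>m\<close> is automatically outside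
\<open>J\<close>.\<close>

definition assoc_primes :: "'a::comm_ring_1 set \<Rightarrow> 'a set set" where
  "assoc_primes J = {P. prime_ideal P \<and> (\<exists>m. P = colon J m)}"

text \<open>A zero divisor \<open>u\<close> modulo the saturation lies in a maximal annihilator \<open>P = (sat X J : q)\<close>. This
prime cannot contain \<open>X\<close>, as \<open>q\<close> would then belong to the saturation. With \<open>x \<in> X - P\<close> and \<open>N\<close>
large enough for a finite set of generators of \<open>P\<close>, the ideal \<open>P\<close> is the annihilator of \<open>x\<^sup>N * q\<close>
modulo \<open>J\<close> itself. So \<open>u\<close> lies in an associated prime of \<open>J\<close> that does not contain \<open>X\<close>.\<close>

lemma (in noetherian_ring) regular_mod_sat:
  fixes X :: "'a set"
  assumes J: "is_ideal J" and X: "finite X"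
    and u: "\<And>P. P \<in> assoc_primes J \<Longrightarrow> u \<in> P \<Longrightarrow> X \<subseteq> P"
  shows "regular_mod (sat X J) u"
  unfolding regular_mod_def
proof (intro allI impI, rule ccontr)
  fix f assume f: "u * f \<in> sat X J" "f \<notin> sat X J"
  obtain P where P: "P \<in> max_annihilators (sat X J)" "colon (sat X J) f \<subseteq> P"
    using colon_subset_max_annihilator[OF sat_ideal[OF J] f(2)] by blast
  have prP: "prime_ideal P" using max_annihilator_prime[OF sat_ideal[OF J] P(1)] .
  obtain q where q: "q \<notin> sat X J" "P = colon (sat X J) q" using P(1) by (rule max_annihilatorsE)
  have uP: "u \<in> P" using P(2) f(1) by (auto simp: colon_def)
  obtain x where x: "x \<in> X" "x \<notin> P"
    using sat_closed[OF J X, of q] q by (auto simp: colon_def)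
  obtain F where F: "finite F" "P = gen F" using finitely_generated[of P] prP unfolding prime_ideal_def by blast
  have "\<forall>p\<in>F. \<exists>k. x ^ k * (p * q) \<in> J"
  proof
    fix p assume "p \<in> F"
    then have "p * q \<in> sat X J" using F(2) gen_base[of p F] q(2) by (auto simp: colon_def)
    then show "\<exists>k. x ^ k * (p * q) \<in> J" using x(1) by (auto simp: sat_def)
  qed
  then obtain k where k: "\<And>p. p \<in> F \<Longrightarrow> x ^ k p * (p * q) \<in> J" by metis
  define N where "N = sum k F"
  have "p \<in> colon J (x ^ N * q)" if p: "p \<in> F" for p
    using power_mult_ideal_mono[OF J k[OF p], of N] member_le_sum[OF p _ F(1), of k]
    by (simp add: N_def colon_def mult.left_commute)
  then have "P \<subseteq> colon J (x ^ N * q)" unfolding F(2) by (intro gen_minimal colon_ideal J) auto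
  moreover have "g \<in> P" if "g \<in> colon J (x ^ N * q)" for g
  proof -
    have "(g * x ^ N) * q \<in> sat X J"
      using that subset_sat[OF J, of X] by (auto simp: colon_def mult.assoc)
    then have "g * x ^ N \<in> P" using q(2) by (simp add: colon_def)
    then show ?thesis using prP x(2) prime_ideal_power[OF prP] unfolding prime_ideal_def by blast
  qed
  ultimately have "P = colon J (x ^ N * q)" by blast
  then have "P \<in> assoc_primes J" using prP unfolding assoc_primes_def by blast
  then show False using u uP x by blast
qed

section \<open>Monomial ideals\<close>

abbreviation mon :: "('n \<Rightarrow>\<^sub>0 nat) \<Rightarrow> ('n::finite, 'k::field) mpol" where
  "mon a \<equiv> Poly_Mapping.single a 1"

definition exps :: "('n::finite, 'k::field) mpol set \<Rightarrow> ('n \<Rightarrow>\<^sub>0 nat) set" where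
  "exps J = {a. mon a \<in> J}"

lemma mon_add: "(mon (a + b) :: ('n::finite, 'k::field) mpol) = mon a * mon b"
  by (simp add: mult_single)

lemma exps_up: "is_ideal J \<Longrightarrow> a \<in> exps J \<Longrightarrow> exp_le a b \<Longrightarrow> b \<in> exps J"
  by (auto simp: exps_def mon_add elim!: exp_leE intro: ideal_mult_right)

definition span_exps :: "('n \<Rightarrow>\<^sub>0 nat) set \<Rightarrow> ('n::finite, 'k::field) mpol set" where
  "span_exps A = {f. Poly_Mapping.keys f \<subseteq> A}"

lemma span_exps_ideal:
  assumes "\<And>a b. a \<in> A \<Longrightarrow> exp_le a b \<Longrightarrow> b \<in> A"
  shows "is_ideal (span_exps A :: ('n::finite, 'k::field) mpol set)"
proof (rule is_idealI)
  show "0 \<in> span_exps A" by (simp add: span_exps_def)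
  show "f + g \<in> span_exps A" if "f \<in> span_exps A" "g \<in> span_exps A" for f g :: "('n, 'k) mpol"
    using that Poly_Mapping.keys_add[of f g] by (auto simp: span_exps_def)
  show "c * f \<in> span_exps A" if "f \<in> span_exps A" for c f :: "('n, 'k) mpol"
  proof -
    have "x \<in> A" if x: "x \<in> Poly_Mapping.keys (c * f)" for x
    proof -
      obtain a b where "b \<in> Poly_Mapping.keys f" "x = a + b" using x keys_mult[of c f] by blast
      then show ?thesis using \<open>f \<in> span_exps A\<close> assms[of b x] by (auto simp: span_exps_def)
    qed
    then show ?thesis by (auto simp: span_exps_def)
  qed
qed

lemma span_exps_subset:
  fixes J :: "('n::finite, 'k::field) mpol set"
  assumes J: "is_ideal J" and "A \<subseteq> exps J"
  shows "span_exps A \<subseteq> J"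
proof
  fix f :: "('n, 'k) mpol" assume f: "f \<in> span_exps A"
  have "Poly_Mapping.single a c \<in> J" if "a \<in> A" for a c
    using ideal_mult[OF J, of "mon a" "Poly_Mapping.single 0 c"] that assms(2)
    by (auto simp: mult_single exps_def)
  then have "(\<Sum>a\<in>Poly_Mapping.keys f. Poly_Mapping.single a (Poly_Mapping.lookup f a)) \<in> J"
    using f by (intro ideal_sum[OF J]) (auto simp: span_exps_def)
  then show "f \<in> J" using poly_sum_terms[of f] by simp
qed

lemma exps_span_exps [simp]: "exps (span_exps A) = A"
  by (auto simp: exps_def span_exps_def)

lemma gen_monomials:
  "gen (mon ` A) = span_exps {b. \<exists>a\<in>A. exp_le a b}"
proof
  show "gen (mon ` A) \<subseteq> span_exps {b. \<exists>a\<in>A. exp_le a b}"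
    by (intro gen_minimal span_exps_ideal) (auto simp: span_exps_def intro: exp_le_trans exp_le_refl)
  have "a \<in> exps (gen (mon ` A))" if "a \<in> A" for a
    using that by (auto simp: exps_def intro: gen_base)
  then have "{b. \<exists>a\<in>A. exp_le a b} \<subseteq> exps (gen (mon ` A))"
    using exps_up[OF gen_ideal] by blast
  then show "span_exps {b. \<exists>a\<in>A. exp_le a b} \<subseteq> gen (mon ` A)"
    by (intro span_exps_subset gen_ideal)
qed

lemma ideal_poly_ring_iff:
  "ideal J (poly_ring :: ('n::finite, 'k::field) mpol ring) \<longleftrightarrow> is_ideal J"
proof
  interpret cring "poly_ring :: ('n, 'k) mpol ring" by (rule poly_ring_cring)
  assume "ideal J (poly_ring :: ('n, 'k) mpol ring)"
  then interpret ideal J "poly_ring :: ('n, 'k) mpol ring" .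
  show "is_ideal J"
    using zero_closed a_closed I_l_closed
    by (intro is_idealI) (auto simp: poly_ring_def)
next
  interpret cring "poly_ring :: ('n, 'k) mpol ring" by (rule poly_ring_cring)
  assume J: "is_ideal J"
  have inv: "inv\<^bsub>add_monoid (poly_ring :: ('n, 'k) mpol ring)\<^esub> x = - x" for x
    using minus_unique[of x "- x"] unfolding a_inv_def[symmetric]
    by (intro minus_equality) (auto simp: poly_ring_def)
  show "ideal J (poly_ring :: ('n, 'k) mpol ring)"
  proof (rule idealI)
    show "ring (poly_ring :: ('n, 'k) mpol ring)" by (rule ring_axioms)
    have "- x \<in> J" if "x \<in> J" for x using ideal_mult[OF J that, of "- 1"] by simp
    then show "subgroup J (add_monoid (poly_ring :: ('n, 'k) mpol ring))"
      using ideal_zero[OF J] ideal_add[OF J]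
      by (intro subgroup.intro; (simp only: inv)?) (simp_all add: poly_ring_def)
  qed (auto simp: poly_ring_def intro: ideal_mult[OF J] ideal_mult_right[OF J])
qed

lemma Idl_poly_ring:
  "Idl\<^bsub>poly_ring\<^esub> G = gen (G :: ('n::finite, 'k::field) mpol set)"
proof
  show "Idl\<^bsub>poly_ring\<^esub> G \<subseteq> gen G"
    unfolding genideal_def ideal_poly_ring_iff using gen_ideal[of G] gen_superset[of G] by blast
  show "gen G \<subseteq> Idl\<^bsub>poly_ring\<^esub> G"
    unfolding genideal_def ideal_poly_ring_iff using gen_minimal[of G] by blast
qed

lemma monomial_iff: "monomial u \<longleftrightarrow> u \<in> range mon"
  by (auto simp: monomial_def)

text \<open>A monomial ideal is determined by the exponents of its monomials; this reduces all questions about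
such ideals to sets of exponent vectors.\<close>

lemma monomial_ideal_iff:
  "monomial_ideal J \<longleftrightarrow> is_ideal J \<and> J = span_exps (exps J)"
proof
  assume "monomial_ideal J"
  then obtain G where G: "\<forall>g\<in>G. monomial g" "J = gen G"
    by (auto simp: monomial_ideal_def Idl_poly_ring)
  then have "G \<subseteq> range mon" by (auto simp: monomial_iff)
  then obtain A where "G = mon ` A" by (rule subset_imageE)
  then have "J = span_exps {b. \<exists>a\<in>A. exp_le a b}" using G(2) gen_monomials[of A] by (simp only:)
  then have "J = span_exps (exps J)" by (simp only: exps_span_exps)
  then show "is_ideal J \<and> J = span_exps (exps J)" using gen_ideal[of G] G(2) by blast
next
  assume J: "is_ideal J \<and> J = span_exps (exps J)"
  have "gen (mon ` exps J) = J"
  proof -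
    have "{b. \<exists>a\<in>exps J. exp_le a b} = exps J" using J exps_up[of J] exp_le_refl by blast
    then show ?thesis unfolding gen_monomials using J by simp
  qed
  then show "monomial_ideal J"
    unfolding monomial_ideal_def Idl_poly_ring by (intro exI[of _ "mon ` exps J"]) (auto simp: monomial_def)
qed

lemma monomial_ideal_mem: "monomial_ideal J \<Longrightarrow> f \<in> J \<longleftrightarrow> Poly_Mapping.keys f \<subseteq> exps J"
  by (subst (asm) monomial_ideal_iff) (auto simp: span_exps_def)

lemma monomial_ideal_is_ideal: "monomial_ideal J \<Longrightarrow> is_ideal J"
  by (simp add: monomial_ideal_iff)

lemma gen_insert_monomial:
  assumes "monomial_ideal (J :: ('n::finite, 'k::field) mpol set)"
  shows "monomial_ideal (gen (insert (mon e) J))"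
    and "exps (gen (insert (mon e) J)) = exps J \<union> {a. exp_le e a}"
proof -
  note J = monomial_ideal_is_ideal[OF assms]
  let ?A = "exps J \<union> {a. exp_le e a}"
  have "gen (insert (mon e) J) = span_exps ?A"
  proof
    show "gen (insert (mon e) J) \<subseteq> span_exps ?A"
    proof (intro gen_minimal span_exps_ideal)
      show "insert (mon e) J \<subseteq> span_exps ?A"
        using monomial_ideal_mem[OF assms] by (auto simp: span_exps_def)
    qed (auto intro: exp_le_trans exps_up[OF J])
    have "exps J \<subseteq> exps (gen (insert (mon e) J))" by (auto simp: exps_def intro: gen_base)
    moreover have "e \<in> exps (gen (insert (mon e) J))" by (auto simp: exps_def intro: gen_base)
    ultimately have "?A \<subseteq> exps (gen (insert (mon e) J))" using exps_up[OF gen_ideal] by auto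
    then show "span_exps ?A \<subseteq> gen (insert (mon e) J)" by (rule span_exps_subset[OF gen_ideal])
  qed
  then show "exps (gen (insert (mon e) J)) = ?A" "monomial_ideal (gen (insert (mon e) J))"
    by (simp_all add: monomial_ideal_iff) (metis gen_ideal)
qed

lemma range_var: "range var = mon ` range (\<lambda>i :: 'n::finite. Poly_Mapping.single i 1)"
  by (auto simp: var_def)

lemma max_ideal_gen: "max_ideal = gen (range var)"
  by (simp add: max_ideal_def Idl_poly_ring)

lemma max_ideal_ideal: "is_ideal max_ideal"
  by (simp add: max_ideal_gen gen_ideal)

lemma exp_le_single_iff: "exp_le (Poly_Mapping.single i k) a \<longleftrightarrow> k \<le> Poly_Mapping.lookup a i"
  by (auto simp: exp_le_def lookup_single when_def)

lemma max_ideal_eq: "(max_ideal :: ('n::finite, 'k::field) mpol set) = span_exps {a. a \<noteq> 0}"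
proof -
  have "{b. \<exists>a\<in>range (\<lambda>i :: 'n. Poly_Mapping.single i (1 :: nat)). exp_le a b} = {a. a \<noteq> 0}"
  proof (intro Set.set_eqI iffI)
    fix b :: "'n \<Rightarrow>\<^sub>0 nat" assume "b \<in> {a. a \<noteq> 0}"
    then obtain i where "Poly_Mapping.lookup b i \<noteq> 0" by (auto simp: poly_mapping_eq_iff fun_eq_iff)
    then show "b \<in> {b. \<exists>a\<in>range (\<lambda>i :: 'n. Poly_Mapping.single i 1). exp_le a b}"
      by (auto simp: exp_le_single_iff Suc_le_eq)
  qed (auto simp: exp_le_single_iff)
  then show ?thesis unfolding max_ideal_gen range_var gen_monomials by simp
qed

lemma mon_in_max_ideal: "mon e \<in> max_ideal \<longleftrightarrow> e \<noteq> 0"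
  by (simp add: max_ideal_eq span_exps_def)

lemma monomial_ideal_subset_max_ideal:
  assumes "monomial_ideal J" "J \<noteq> UNIV"
  shows "J \<subseteq> max_ideal"
proof -
  have "0 \<notin> exps J"
  proof
    assume "0 \<in> exps J"
    then have "exps J = UNIV" using exps_up[OF monomial_ideal_is_ideal[OF assms(1)], of 0] by (auto simp: exp_le_def)
    then show False using assms monomial_ideal_mem[OF assms(1)] by blast
  qed
  then have "exps J \<subseteq> {a. a \<noteq> 0}" by (intro subsetI) (metis mem_Collect_eq)
  then show ?thesis using monomial_ideal_mem[OF assms(1)] by (auto simp: max_ideal_eq span_exps_def)
qed

lemma has_socle_max_ideal:
  assumes "is_ideal J"
  shows "has_socle max_ideal J \<longleftrightarrow> has_socle (range var) J"
proof -
  have "(\<forall>a\<in>max_ideal. a * w \<in> J) \<longleftrightarrow> (\<forall>a\<in>range var. a * w \<in> J)" for w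
  proof
    assume "\<forall>a\<in>range var. a * w \<in> J"
    then have "range var \<subseteq> colon J w" by (auto simp: colon_def)
    then have "max_ideal \<subseteq> colon J w"
      unfolding max_ideal_gen by (intro gen_minimal colon_ideal assms)
    then show "\<forall>a\<in>max_ideal. a * w \<in> J" by (auto simp: colon_def)
  next
    assume "\<forall>a\<in>max_ideal. a * w \<in> J"
    then show "\<forall>a\<in>range var. a * w \<in> J" using gen_superset[of "range var"] unfolding max_ideal_gen by blast
  qed
  then show ?thesis by (simp only: has_socle_def)
qed

text \<open>By \<open>socle_of_sat\<close> an ideal without socle is saturated.\<close>

lemma filter_regular_imp_regular:
  assumes J: "is_ideal J" and reg: "regular_mod (sat (range var) J) u"
    and "\<not> has_socle max_ideal J"
  shows "regular_mod J u"
proof -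
  have "sat (range var) J = J"
    using socle_of_sat[OF J, of "range var"] subset_sat[OF J] assms(3) has_socle_max_ideal[OF J] by auto
  then show ?thesis using reg by simp
qed

text \<open>The graded version of Nakayama's lemma for the saturation modulo \<open>J\<close>, carried out on monomials: a
monomial of least degree among those in the saturation but not in \<open>J\<close> survives modulo \<open>(J, x\<^sup>e)\<close>. It
is killed by powers of the variables, and \<open>socle_of_sat\<close> yields an element killed by the variables
themselves.\<close>

lemma socle_mod_filter_regular:
  assumes mJ: "monomial_ideal (J :: ('n::finite, 'k::field) mpol set)"
    and e: "e \<noteq> 0" and reg: "regular_mod (sat (range var) J) (mon e)"
    and s: "has_socle max_ideal J"
  shows "has_socle max_ideal (gen (insert (mon e) J))"
proof -
  note J = monomial_ideal_is_ideal[OF mJ]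
  let ?H = "{a. mon a \<in> sat (range var) J \<and> a \<notin> exps J}"
  obtain w where w: "w \<notin> J" "\<And>i. var i * w \<in> J"
    using s unfolding has_socle_max_ideal[OF J] by (auto simp: has_socle_def)
  obtain a where a: "a \<in> Poly_Mapping.keys w" "a \<notin> exps J"
    using w(1) monomial_ideal_mem[OF mJ] by blast
  \<comment> \<open>The terms of the socle element \<open>w\<close> outside \<open>J\<close> are socle elements as well, since \<open>J\<close> is monomial.\<close>
  have "var i * mon a \<in> J" for i
  proof -
    have "Poly_Mapping.lookup (var i * w) (Poly_Mapping.single i 1 + a) \<noteq> 0"
      using a(1) unfolding var_def lookup_single_times by (simp add: in_keys_iff)
    then have "Poly_Mapping.single i 1 + a \<in> exps J"
      using w(2)[of i] monomial_ideal_mem[OF mJ] by (auto simp: in_keys_iff)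
    then show ?thesis by (simp add: exps_def var_def mon_add)
  qed
  then have "mon a \<in> sat (range var) J" unfolding sat_def by (auto intro!: exI[of _ 1])
  then have "a \<in> ?H" using a by simp
  then obtain b where b: "b \<in> ?H" "\<And>c. c \<in> ?H \<Longrightarrow> exp_deg b \<le> exp_deg c"
    using ex_has_least_nat[of "\<lambda>a. a \<in> ?H" a exp_deg] by blast
  have "mon b \<notin> gen (insert (mon e) J)"
  proof
    assume "mon b \<in> gen (insert (mon e) J)"
    then have "b \<in> exps J \<union> {a. exp_le e a}"
      unfolding gen_insert_monomial(2)[OF mJ, symmetric] by (simp add: exps_def)
    then obtain c where c: "b = e + c" using b(1) by (auto elim: exp_leE)
    then have "mon e * mon c \<in> sat (range var) J" using b(1) by (simp add: mult_single)
    then have "mon c \<in> sat (range var) J" using reg by (simp add: regular_mod_def)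
    moreover have "c \<notin> exps J" using b(1) exps_up[OF J, of c b] c by auto
    ultimately have "exp_deg b \<le> exp_deg c" using b(2) by blast
    then show False using c e by (simp add: exp_deg_add exp_deg_eq_0)
  qed
  moreover have "mon b \<in> sat (range var) (gen (insert (mon e) J))"
    using b(1) sat_mono[of J "gen (insert (mon e) J)"] gen_superset[of "insert (mon e) J"] by blast
  ultimately show ?thesis
    unfolding has_socle_max_ideal[OF gen_ideal] by (intro socle_of_sat gen_ideal) auto
qed

section \<open>Depth of quotients of the polynomial ring\<close>

lemma primeideal_poly_ring_iff:
  "primeideal P (poly_ring :: ('n::finite, 'k::field) mpol ring) \<longleftrightarrow> prime_ideal P"
proof -
  interpret cring "poly_ring :: ('n, 'k) mpol ring" by (rule poly_ring_cring)
  have one: "1 \<in> P \<longleftrightarrow> P = UNIV" if "is_ideal P" for P :: "('n, 'k) mpol set"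
    using ideal_mult[OF that, of 1] by auto
  show ?thesis
  proof
    assume "primeideal P (poly_ring :: ('n, 'k) mpol ring)"
    then interpret primeideal P "poly_ring :: ('n, 'k) mpol ring" .
    have i: "is_ideal P" using is_ideal ideal_poly_ring_iff by blast
    moreover have "P \<noteq> UNIV" using I_notcarr by (auto simp: poly_ring_def)
    moreover have "a * b \<in> P \<Longrightarrow> a \<in> P \<or> b \<in> P" for a b using I_prime[of a b] by (simp add: poly_ring_def)
    ultimately show "prime_ideal P" using one[OF i] by (auto simp: prime_ideal_def)
  next
    assume P: "prime_ideal P"
    show "primeideal P (poly_ring :: ('n, 'k) mpol ring)"
    proof (rule primeidealI)
      show "ideal P (poly_ring :: ('n, 'k) mpol ring)"
        using P by (simp add: ideal_poly_ring_iff prime_ideal_def)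
      show "cring (poly_ring :: ('n, 'k) mpol ring)" by (rule poly_ring_cring)
    qed (use P in \<open>auto simp: prime_ideal_def poly_ring_def\<close>)
  qed
qed

context Module.module begin

lemma submodule_abelian_subgroup: "submodule N R M \<Longrightarrow> abelian_subgroup N M"
  by (rule abelian_subgroupI3)
    (auto intro!: additive_subgroup.intro intro: submodule.axioms(1) M.abelian_group_axioms)

lemma quot_module_carrier: "carrier (quot_module M N) = (\<lambda>x. N +>\<^bsub>M\<^esub> x) ` carrier M"
  by (auto simp: quot_module_def A_RCOSETS_def RCOSETS_def a_r_coset_def)

lemma quot_module_zero: "\<zero>\<^bsub>quot_module M N\<^esub> = N"
  by (simp add: quot_module_def)

lemma coset_eq_submodule_iff:
  assumes N: "submodule N R M" and x: "x \<in> carrier M"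
  shows "N +>\<^bsub>M\<^esub> x = N \<longleftrightarrow> x \<in> N"
proof -
  interpret A: abelian_subgroup N M by (rule submodule_abelian_subgroup[OF N])
  show ?thesis using A.a_rcos_self[OF x] A.a_rcos_const by auto
qed

lemma smult_quot_module_eq_zero_iff:
  assumes N: "submodule N R M" and "a \<in> carrier R" "x \<in> carrier M"
  shows "a \<odot>\<^bsub>quot_module M N\<^esub> (N +>\<^bsub>M\<^esub> x) = \<zero>\<^bsub>quot_module M N\<^esub> \<longleftrightarrow> a \<odot>\<^bsub>M\<^esub> x \<in> N"
  using assms by (simp add: quot_module_smult quot_module_zero coset_eq_submodule_iff)

lemma quot_module_trivial_iff:
  assumes N: "submodule N R M"
  shows "carrier (quot_module M N) = {\<zero>\<^bsub>quot_module M N\<^esub>} \<longleftrightarrow> carrier M \<subseteq> N"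
proof -
  have "\<zero>\<^bsub>M\<^esub> \<in> carrier M" by simp
  then show ?thesis
    unfolding quot_module_carrier quot_module_zero using coset_eq_submodule_iff[OF N] by blast
qed

lemma regular_elem_quot_module_iff:
  assumes N: "submodule N R M" and a: "a \<in> carrier R"
  shows "regular_elem (quot_module M N) a \<longleftrightarrow> (\<forall>x\<in>carrier M. a \<odot>\<^bsub>M\<^esub> x \<in> N \<longrightarrow> x \<in> N)"
  unfolding regular_elem_def quot_module_carrier ball_simps
  using smult_quot_module_eq_zero_iff[OF N a] coset_eq_submodule_iff[OF N]
  by (simp add: quot_module_zero)

lemma Ass_quot_module:
  assumes N: "submodule N R M"
  shows "Ass R (quot_module M N) =
    {P. primeideal P R \<and> (\<exists>x\<in>carrier M. P = {a \<in> carrier R. a \<odot>\<^bsub>M\<^esub> x \<in> N})}"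
proof -
  have "{a \<in> carrier R. a \<odot>\<^bsub>quot_module M N\<^esub> (N +>\<^bsub>M\<^esub> x) = \<zero>\<^bsub>quot_module M N\<^esub>} =
      {a \<in> carrier R. a \<odot>\<^bsub>M\<^esub> x \<in> N}" if "x \<in> carrier M" for x
    using smult_quot_module_eq_zero_iff[OF N _ that] by blast
  then show ?thesis unfolding Ass_def quot_module_carrier bex_simps by (simp cong: bex_cong)
qed

end

abbreviation S_reg :: "(('n::finite, 'k::field) mpol, ('n, 'k) mpol) module" where
  "S_reg \<equiv> regular_module poly_ring"

lemma S_reg_module: "Module.module poly_ring S_reg"
  by (rule cring.regular_module_module[OF poly_ring_cring])

lemma S_reg_simps:
  "carrier S_reg = UNIV" "a \<odot>\<^bsub>S_reg\<^esub> x = a * x" "x \<oplus>\<^bsub>S_reg\<^esub> y = x + y" "\<zero>\<^bsub>S_reg\<^esub> = 0"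
  "carrier poly_ring = UNIV"
  by (simp_all add: regular_module_def poly_ring_def)

lemma submodule_S_reg:
  assumes J: "is_ideal (J :: ('n::finite, 'k::field) mpol set)"
  shows "submodule J poly_ring S_reg"
proof -
  interpret Module.module poly_ring "S_reg :: (('n, 'k) mpol, ('n, 'k) mpol) module"
    by (rule S_reg_module)
  have "\<ominus>\<^bsub>S_reg\<^esub> x = - x" for x :: "('n, 'k) mpol"
    by (intro M.minus_equality) (simp_all add: S_reg_simps)
  moreover have "- x \<in> J" if "x \<in> J" for x using ideal_mult[OF J that, of "- 1"] by simp
  ultimately show ?thesis
    by (intro submoduleI) (simp_all add: S_reg_simps ideal_zero[OF J] ideal_add[OF J] ideal_mult[OF J])
qed

abbreviation residue :: "('n::finite, 'k::field) mpol set \<Rightarrow> ('n, 'k) mpol \<Rightarrow> ('n, 'k) mpol set" where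
  "residue J x \<equiv> J +>\<^bsub>S_reg\<^esub> x"

lemma residue_poly_ring: "J +>\<^bsub>poly_ring\<^esub> x = residue J x"
  by (simp add: a_r_coset_def r_coset_def poly_ring_def regular_module_def)

lemma S_mod_module: "is_ideal J \<Longrightarrow> Module.module poly_ring (S_mod J)"
  by (rule module.quot_module_module[OF S_reg_module submodule_S_reg])

lemma S_mod_carrier: "carrier (S_mod J) = range (residue J)"
  by (simp add: module.quot_module_carrier[OF S_reg_module] S_reg_simps)

lemma S_mod_smult: "is_ideal J \<Longrightarrow> a \<odot>\<^bsub>S_mod J\<^esub> residue J x = residue J (a * x)"
  by (simp add: module.quot_module_smult[OF S_reg_module submodule_S_reg] S_reg_simps)

lemma S_mod_add:
  assumes "is_ideal J" shows "residue J x \<oplus>\<^bsub>S_mod J\<^esub> residue J y = residue J (x + y)"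
proof -
  interpret A: abelian_subgroup J S_reg
    by (rule module.submodule_abelian_subgroup[OF S_reg_module submodule_S_reg[OF assms]])
  show ?thesis using A.a_rcos_sum[of x y] by (simp add: quot_module_def S_reg_simps)
qed

lemma S_mod_zero: "is_ideal J \<Longrightarrow> \<zero>\<^bsub>S_mod J\<^esub> = residue J 0"
  using module.coset_eq_submodule_iff[OF S_reg_module submodule_S_reg, of J 0] ideal_zero[of J]
  by (simp add: module.quot_module_zero[OF S_reg_module] S_reg_simps)

lemma residue_eq_iff:
  assumes J: "is_ideal J" shows "residue J x = residue J y \<longleftrightarrow> x - y \<in> J"
proof -
  have r: "residue J z = {h + z | h. h \<in> J}" for z
    by (auto simp: a_r_coset_def r_coset_def regular_module_def poly_ring_def)
  show ?thesis
  proof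
    assume "residue J x = residue J y"
    moreover have "x \<in> residue J x" unfolding r using ideal_zero[OF J] by force
    ultimately show "x - y \<in> J" unfolding r by auto
  next
    assume xy: "x - y \<in> J"
    show "residue J x = residue J y"
    proof (intro equalityI subsetI)
      fix z assume "z \<in> residue J x"
      then obtain h where h: "h \<in> J" "z = h + x" unfolding r by blast
      then have "z = (h + (x - y)) + y" by simp
      then show "z \<in> residue J y" unfolding r using ideal_add[OF J h(1) xy] by blast
    next
      fix z assume "z \<in> residue J y"
      then obtain h where h: "h \<in> J" "z = h + y" unfolding r by blast
      then have "z = (h - (x - y)) + x" by simp
      then show "z \<in> residue J x" unfolding r using ideal_diff[OF J h(1) xy] by blast
    qed
  qed
qed

text \<open>The submodule generated by \<open>A\<close> in \<open>S/J\<close> is the image of \<open>(J, A)\<close>. This identifies the iterated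
quotients in the definitions of regular and filter-regular sequences with ideals of \<open>S\<close>.\<close>

lemma ideal_smult_S_mod:
  assumes J: "is_ideal J"
  shows "ideal_smult poly_ring (Idl\<^bsub>poly_ring\<^esub> A) (S_mod J) = residue J ` gen (J \<union> A)" (is "?L = ?T")
    and "submodule (residue J ` gen (J \<union> A)) poly_ring (S_mod J)"
proof -
  interpret Module.module poly_ring "S_mod J" by (rule S_mod_module[OF J])
  note G = gen_ideal[of "J \<union> A"]
  have inv: "\<ominus>\<^bsub>S_mod J\<^esub> residue J x = residue J (- x)" for x
    by (intro M.minus_equality) (auto simp: S_mod_add[OF J] S_mod_zero[OF J] S_mod_carrier)
  show sub: "submodule ?T poly_ring (S_mod J)"
  proof (rule submoduleI)
    show "?T \<subseteq> carrier (S_mod J)" by (auto simp: S_mod_carrier)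
    show "\<zero>\<^bsub>S_mod J\<^esub> \<in> ?T" using ideal_zero[OF G] by (auto simp: S_mod_zero[OF J])
    fix X assume "X \<in> ?T"
    then obtain x where x: "x \<in> gen (J \<union> A)" "X = residue J x" by blast
    show "\<ominus>\<^bsub>S_mod J\<^esub> X \<in> ?T"
      using ideal_mult[OF G x(1), of "- 1"] by (auto simp: x inv)
    show "a \<odot>\<^bsub>S_mod J\<^esub> X \<in> ?T" for a
      using ideal_mult[OF G x(1), of a] by (auto simp: x S_mod_smult[OF J])
    fix Y assume "Y \<in> ?T"
    then obtain y where y: "y \<in> gen (J \<union> A)" "Y = residue J y" by blast
    show "X \<oplus>\<^bsub>S_mod J\<^esub> Y \<in> ?T"
      using ideal_add[OF G x(1) y(1)] by (auto simp: x y S_mod_add[OF J])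
  qed
  show "?L = ?T"
  proof
    have "a \<odot>\<^bsub>S_mod J\<^esub> m \<in> ?T" if am: "a \<in> gen A" "m \<in> carrier (S_mod J)" for a m
    proof -
      obtain x where x: "m = residue J x" using am(2) by (auto simp: S_mod_carrier)
      have "a \<in> gen (J \<union> A)" using am(1) gen_mono[of A "J \<union> A"] by blast
      then show ?thesis using ideal_mult_right[OF G] by (auto simp: x S_mod_smult[OF J])
    qed
    then show "?L \<subseteq> ?T" unfolding ideal_smult_def Idl_poly_ring using sub by (intro Inter_lower) blast
    show "?T \<subseteq> ?L" unfolding ideal_smult_def Idl_poly_ring
    proof (intro Inter_greatest subsetI)
      fix N X assume "N \<in> {N. submodule N poly_ring (S_mod J) \<and>
        (\<forall>a\<in>gen A. \<forall>m\<in>carrier (S_mod J). a \<odot>\<^bsub>S_mod J\<^esub> m \<in> N)}" and "X \<in> ?T"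
      then have N: "\<And>a x. a \<in> gen A \<Longrightarrow> residue J (a * x) \<in> N"
        by (auto simp: S_mod_carrier S_mod_smult[OF J])
      obtain x where x: "x \<in> gen (J \<union> A)" "X = residue J x" using \<open>X \<in> ?T\<close> by blast
      then obtain j y where jy: "x = j + y" "j \<in> gen J" "y \<in> gen A"
        unfolding Modules.module.span_Un[OF module_mult] by blast
      then have "j \<in> J" using J gen_eq_self by blast
      then have "residue J x = residue J y" using jy(1) by (simp add: residue_eq_iff[OF J])
      then show "X \<in> N" using N[OF jy(3), of 1] x(2) by simp
    qed
  qed
qed

lemma residue_in_image_iff:
  assumes "is_ideal J" "is_ideal G" "J \<subseteq> G"
  shows "residue J x \<in> residue J ` G \<longleftrightarrow> x \<in> G"
proof
  assume "residue J x \<in> residue J ` G"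
  then obtain y where y: "y \<in> G" "x - y \<in> J" by (auto simp: residue_eq_iff[OF assms(1)])
  then have "(x - y) + y \<in> G" using assms by (intro ideal_add[OF assms(2)]) auto
  then show "x \<in> G" by simp
qed auto

lemma quot_by_S_mod:
  assumes J: "is_ideal J"
  shows quot_by_trivial_iff: "carrier (quot_by poly_ring (S_mod J) as) = {\<zero>\<^bsub>quot_by poly_ring (S_mod J) as\<^esub>} \<longleftrightarrow>
      gen (J \<union> set as) = UNIV"
    and regular_elem_quot_by_iff: "regular_elem (quot_by poly_ring (S_mod J) as) a \<longleftrightarrow> regular_mod (gen (J \<union> set as)) a"
    and Ass_quot_by: "Ass poly_ring (quot_by poly_ring (S_mod J) as) = assoc_primes (gen (J \<union> set as))"
proof -
  interpret Module.module poly_ring "S_mod J" by (rule S_mod_module[OF J])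
  note sub = ideal_smult_S_mod(2)[OF J, of "set as"]
  have JG: "J \<subseteq> gen (J \<union> set as)" by (auto intro: gen_base)
  note mem = residue_in_image_iff[OF J gen_ideal JG]
  show "carrier (quot_by poly_ring (S_mod J) as) = {\<zero>\<^bsub>quot_by poly_ring (S_mod J) as\<^esub>} \<longleftrightarrow>
      gen (J \<union> set as) = UNIV"
    unfolding quot_by_def ideal_smult_S_mod(1)[OF J] quot_module_trivial_iff[OF sub] S_mod_carrier
      image_subset_iff mem by blast
  show "regular_elem (quot_by poly_ring (S_mod J) as) a \<longleftrightarrow> regular_mod (gen (J \<union> set as)) a"
    unfolding quot_by_def ideal_smult_S_mod(1)[OF J]
    by (subst regular_elem_quot_module_iff[OF sub])
      (simp_all add: S_mod_carrier S_reg_simps S_mod_smult[OF J] mem regular_mod_def)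
  show "Ass poly_ring (quot_by poly_ring (S_mod J) as) = assoc_primes (gen (J \<union> set as))"
    unfolding quot_by_def ideal_smult_S_mod(1)[OF J] Ass_quot_module[OF sub]
    by (simp add: S_mod_carrier S_reg_simps S_mod_smult[OF J] mem assoc_primes_def
        primeideal_poly_ring_iff colon_def)
qed

lemma regseq_iff:
  "is_ideal J \<Longrightarrow> regseq J as \<longleftrightarrow> (\<forall>i<length as. regular_mod (gen (J \<union> set (take i as))) (as ! i))"
proof (induction as arbitrary: J)
  case (Cons a as)
  have 0: "gen J = J" using Cons.prems gen_eq_self by blast
  show ?case
    using Cons.IH[OF gen_ideal, of "insert a J"]
    by (simp add: All_less_Suc2 0 gen_insert_Un)
qed simp

lemma regular_seq_S_mod:
  assumes J: "is_ideal J"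
  shows "regular_seq poly_ring (S_mod J) as \<longleftrightarrow> regseq J as \<and> gen (J \<union> set as) \<noteq> UNIV"
  unfolding regular_seq_def quot_by_S_mod[OF J] regseq_iff[OF J] by simp

lemma S_mod_trivial_iff:
  "is_ideal J \<Longrightarrow> carrier (S_mod J) = {\<zero>\<^bsub>S_mod J\<^esub>} \<longleftrightarrow> J = UNIV"
  using module.quot_module_trivial_iff[OF S_reg_module submodule_S_reg, of J]
  by (auto simp: S_reg_simps)

lemma depth_S_mod:
  assumes J: "is_ideal J" "J \<subseteq> max_ideal"
  shows "depth (S_mod J) = (SUP as\<in>{as. set as \<subseteq> max_ideal \<and> regseq J as}. enat (length as))"
proof -
  have "1 \<notin> max_ideal" using mon_in_max_ideal[of 0] by simp
  then have "gen (J \<union> set as) \<noteq> UNIV" if "set as \<subseteq> max_ideal" for as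
    using gen_minimal[OF _ max_ideal_ideal, of "J \<union> set as"] that J(2) by blast
  then have "{as. set as \<subseteq> max_ideal \<and> regular_seq poly_ring (S_mod J) as} =
      {as. set as \<subseteq> max_ideal \<and> regseq J as}"
    using regular_seq_S_mod[OF J(1)] by blast
  moreover have "J \<noteq> UNIV" using J(2) \<open>1 \<notin> max_ideal\<close> by blast
  ultimately show ?thesis unfolding depth_def S_mod_trivial_iff[OF J(1)] by simp
qed

lemma depth_eq_0:
  assumes J: "is_ideal J" "J \<subseteq> max_ideal" and s: "has_socle max_ideal J"
  shows "depth (S_mod J) = 0"
proof -
  have "as = []" if "set as \<subseteq> max_ideal" "regseq J as" for as
    using that s regular_no_socle[of _ max_ideal J] by (cases as) auto
  then have "{as. set as \<subseteq> max_ideal \<and> regseq J as} = {[]}" by auto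
  then show ?thesis unfolding depth_S_mod[OF J] by (simp add: zero_enat_def)
qed

text \<open>Prefixing \<open>u\<close> to a sequence that is regular modulo \<open>(J, u)\<close> gives one inequality, and
\<open>regseq_mod_regular_element\<close> gives the other.\<close>

lemma depth_mod_regular:
  fixes J :: "('n::finite, 'k::field) mpol set"
  assumes J: "is_ideal J" "J \<subseteq> max_ideal" and u: "u \<in> max_ideal" "regular_mod J u"
  shows "depth (S_mod J) = eSuc (depth (S_mod (gen (insert u J))))"
proof -
  let ?A = "{as. set as \<subseteq> max_ideal \<and> regseq J as}"
  let ?B = "{as. set as \<subseteq> max_ideal \<and> regseq (gen (insert u J)) as}"
  have J': "gen (insert u J) \<subseteq> max_ideal"
    using J u by (intro gen_minimal max_ideal_ideal) auto
  have B: "depth (S_mod (gen (insert u J))) = (SUP as\<in>?B. enat (length as))"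
    by (rule depth_S_mod[OF gen_ideal J'])
  have "enat (length as) \<le> eSuc (SUP as\<in>?B. enat (length as))" if as: "as \<in> ?A" for as
  proof (cases "as = []")
    case False
    then obtain bs where bs: "bs \<in> ?B" "length bs = length as - 1"
      using mpol.regseq_mod_regular_element[OF max_ideal_ideal J(1), of as u] as u by auto
    have "enat (length bs) \<le> (SUP as\<in>?B. enat (length as))" using bs(1) by (rule SUP_upper)
    then have "eSuc (enat (length bs)) \<le> eSuc (SUP as\<in>?B. enat (length as))" by simp
    moreover have "eSuc (enat (length bs)) = enat (length as)"
      using bs(2) False by (simp add: eSuc_enat)
    ultimately show ?thesis by simp
  qed (simp add: zero_enat_def[symmetric])
  moreover have "eSuc (SUP as\<in>?B. enat (length as)) \<le> (SUP as\<in>?A. enat (length as))"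
  proof -
    have ne: "(\<lambda>as. enat (length as)) ` ?B \<noteq> {}" by (auto intro!: exI[of _ "[]"])
    have "eSuc (SUP as\<in>?B. enat (length as)) = (SUP x\<in>(\<lambda>as. enat (length as)) ` ?B. eSuc x)"
      by (rule eSuc_Sup[OF ne])
    also have "\<dots> \<le> (SUP as\<in>?A. enat (length as))"
    proof (rule SUP_least)
      fix x assume "x \<in> (\<lambda>as. enat (length as)) ` ?B"
      then obtain as where as: "as \<in> ?B" "x = enat (length as)" by blast
      then have "u # as \<in> ?A" using u by simp
      then have "enat (length (u # as)) \<le> (SUP as\<in>?A. enat (length as))" by (rule SUP_upper)
      then show "eSuc x \<le> (SUP as\<in>?A. enat (length as))" using as(2) by (simp add: eSuc_enat)
    qed
    finally show ?thesis .
  qed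
  ultimately show ?thesis unfolding depth_S_mod[OF J] B by (intro antisym SUP_least)
qed

section \<open>Stanley decompositions as partitions into cones\<close>

abbreviation lk :: "('n \<Rightarrow>\<^sub>0 nat) \<Rightarrow> 'n \<Rightarrow> nat" where
  "lk \<equiv> Poly_Mapping.lookup"

text \<open>The exponents of the monomials in the Stanley space \<open>x\<^sup>a K[Z]\<close>, where \<open>p = (a, Z)\<close>.\<close>

definition cone :: "('n \<Rightarrow>\<^sub>0 nat) \<times> 'n set \<Rightarrow> ('n \<Rightarrow>\<^sub>0 nat) set" where
  "cone p = {b. exp_le (fst p) b \<and> (\<forall>i. i \<notin> snd p \<longrightarrow> lk b i = lk (fst p) i)}"

lemma mem_cone: "b \<in> cone (a, Z) \<longleftrightarrow> exp_le a b \<and> (\<forall>i. i \<notin> Z \<longrightarrow> lk b i = lk a i)"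
  by (simp add: cone_def)

lemma apex_in_cone [simp]: "a \<in> cone (a, Z)"
  by (simp add: mem_cone)

lemma cone_eq: "cone (a, Z) = (\<lambda>c. a + c) ` {c. Poly_Mapping.keys c \<subseteq> Z}"
proof (intro Set.set_eqI iffI)
  fix b assume b: "b \<in> cone (a, Z)"
  then obtain c where c: "b = a + c" by (auto simp: mem_cone elim: exp_leE)
  then have "lk c i = 0" if "i \<notin> Z" for i using b that by (auto simp: mem_cone lookup_add)
  then have "Poly_Mapping.keys c \<subseteq> Z" by (auto simp: in_keys_iff)
  then show "b \<in> (\<lambda>c. a + c) ` {c. Poly_Mapping.keys c \<subseteq> Z}" using c by blast
next
  fix b assume "b \<in> (\<lambda>c. a + c) ` {c. Poly_Mapping.keys c \<subseteq> Z}"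
  then obtain c where c: "b = a + c" "Poly_Mapping.keys c \<subseteq> Z" by blast
  have "lk c i = 0" if "i \<notin> Z" for i using c(2) that by (auto simp: in_keys_iff)
  then show "b \<in> cone (a, Z)" by (auto simp: mem_cone lookup_add c(1))
qed

definition restrict_poly :: "'a set \<Rightarrow> ('a \<Rightarrow>\<^sub>0 'b::comm_monoid_add) \<Rightarrow> 'a \<Rightarrow>\<^sub>0 'b" where
  "restrict_poly S f = (\<Sum>a\<in>Poly_Mapping.keys f \<inter> S. Poly_Mapping.single a (Poly_Mapping.lookup f a))"

lemma lookup_restrict_poly:
  "Poly_Mapping.lookup (restrict_poly S f) a = (if a \<in> S then Poly_Mapping.lookup f a else 0)"
  by (auto simp: restrict_poly_def lookup_sum lookup_single when_def in_keys_iff)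

lemma stanley_space_mon:
  "stanley_space (mon a) Z = {f. Poly_Mapping.keys f \<subseteq> cone (a, Z)}"
proof (intro Set.set_eqI iffI)
  fix f :: "('a, 'b) mpol" assume "f \<in> stanley_space (mon a) Z"
  then obtain g where g: "f = mon a * g" "\<forall>c\<in>Poly_Mapping.keys g. Poly_Mapping.keys c \<subseteq> Z"
    by (auto simp: stanley_space_def)
  then have "Poly_Mapping.keys f \<subseteq> (\<lambda>c. a + c) ` Poly_Mapping.keys g"
    by (simp add: keys_single_times)
  then show "f \<in> {f. Poly_Mapping.keys f \<subseteq> cone (a, Z)}" using g(2) unfolding cone_eq by blast
next
  fix f :: "('a, 'b) mpol" assume "f \<in> {f. Poly_Mapping.keys f \<subseteq> cone (a, Z)}"
  then have f: "Poly_Mapping.keys f \<subseteq> cone (a, Z)" by simp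
  define g :: "('a, 'b) mpol" where
    "g = (\<Sum>b\<in>Poly_Mapping.keys f. Poly_Mapping.single (b - a) (Poly_Mapping.lookup f b))"
  have sub: "a + (b - a) = b" if "b \<in> Poly_Mapping.keys f" for b
    using f that unfolding cone_eq by auto
  have "mon a * g = (\<Sum>b\<in>Poly_Mapping.keys f. Poly_Mapping.single b (Poly_Mapping.lookup f b))"
    by (simp add: g_def sum_distrib_left mult_single sub)
  then have 1: "f = mon a * g" using poly_sum_terms[of f] by simp
  have "Poly_Mapping.keys g \<subseteq> (\<lambda>b. b - a) ` Poly_Mapping.keys f"
  proof
    fix c assume "c \<in> Poly_Mapping.keys g"
    then have "(\<Sum>b\<in>Poly_Mapping.keys f. Poly_Mapping.lookup (Poly_Mapping.single (b - a) (Poly_Mapping.lookup f b)) c) \<noteq> 0"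
      by (simp add: g_def in_keys_iff lookup_sum)
    then obtain b where "b \<in> Poly_Mapping.keys f"
      "Poly_Mapping.lookup (Poly_Mapping.single (b - a) (Poly_Mapping.lookup f b)) c \<noteq> 0"
      by (rule sum.not_neutral_contains_not_neutral)
    then show "c \<in> (\<lambda>b. b - a) ` Poly_Mapping.keys f" by (auto simp: lookup_single when_def split: if_splits)
  qed
  moreover have "Poly_Mapping.keys (b - a) \<subseteq> Z" if b: "b \<in> Poly_Mapping.keys f" for b
  proof -
    obtain c where "b = a + c" "Poly_Mapping.keys c \<subseteq> Z" using f b unfolding cone_eq by blast
    then show ?thesis by simp
  qed
  ultimately have "\<forall>c\<in>Poly_Mapping.keys g. Poly_Mapping.keys c \<subseteq> Z" by blast
  then show "f \<in> stanley_space (mon a) Z" unfolding stanley_space_def using 1 by blast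
qed

definition cone_partition :: "('n \<Rightarrow>\<^sub>0 nat) set \<Rightarrow> (('n \<Rightarrow>\<^sub>0 nat) \<times> 'n set) set \<Rightarrow> bool" where
  "cone_partition A P \<longleftrightarrow> finite P \<and> (\<forall>p\<in>P. cone p \<subseteq> A) \<and> (\<forall>b\<in>A. \<exists>!p. p \<in> P \<and> b \<in> cone p)"

text \<open>\<open>fs\<close> is an element of the external direct sum of the Stanley spaces described by \<open>E\<close>.\<close>

definition fits :: "('n::finite, 'k::field) mpol list \<Rightarrow> (('n \<Rightarrow>\<^sub>0 nat) \<times> 'n set) list \<Rightarrow> bool" where
  "fits fs E \<longleftrightarrow> length fs = length E \<and> (\<forall>i<length E. Poly_Mapping.keys (fs ! i) \<subseteq> cone (E ! i))"

lemma stanley_decomposition_iff: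
  assumes J: "is_ideal J"
  shows "stanley_decomposition J (map (\<lambda>(a, Z). (mon a, Z)) E) \<longleftrightarrow>
    (\<forall>x. \<exists>!fs. fits fs E \<and> sum_list fs - x \<in> J)"
proof -
  have la: "list_all2 (\<lambda>f (v, Z). f \<in> stanley_space v Z) fs (map (\<lambda>(a, Z). (mon a, Z)) E) \<longleftrightarrow> fits fs E" for fs
  proof -
    have "list_all2 (\<lambda>f (v, Z). f \<in> stanley_space v Z) fs (map (\<lambda>(a, Z). (mon a, Z)) E) \<longleftrightarrow>
        list_all2 (\<lambda>f p. Poly_Mapping.keys f \<subseteq> cone p) fs E"
      by (simp add: list_all2_map2 case_prod_beta stanley_space_mon)
    then show ?thesis by (auto simp: list_all2_conv_all_nth fits_def)
  qed
  show ?thesis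
    unfolding stanley_decomposition_def la S_mod_carrier residue_poly_ring
    by (auto simp: monomial_def residue_eq_iff[OF J])
qed

lemma lookup_sum_list:
  "Poly_Mapping.lookup (sum_list fs) b = (\<Sum>i<length fs. Poly_Mapping.lookup (fs ! i) b)"
  by (simp add: sum_list_sum_nth lookup_sum atLeast0LessThan)

text \<open>A monomial of \<open>J\<close> in some summand, or a monomial common to two summands, would be represented in two ways;
a monomial outside \<open>J\<close> and outside all summands could not be represented at all, because membership
in \<open>J\<close> is decided term by term.\<close>

lemma stanley_decomposition_imp_partition:
  assumes mJ: "monomial_ideal (J :: ('n::finite, 'k::field) mpol set)"
    and D: "stanley_decomposition J (map (\<lambda>(a, Z). (mon a, Z)) E)"
  shows "cone_partition (- exps J) (set E)"
proof -
  note J = monomial_ideal_is_ideal[OF mJ]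
  have ex: "\<exists>!fs. fits fs E \<and> sum_list fs - x \<in> J" for x
    using D stanley_decomposition_iff[OF J] by blast
  have uniq: "fs = gs" if "fits fs E" "fits gs E" "sum_list fs - sum_list gs \<in> J" for fs gs
  proof -
    have "sum_list gs - sum_list gs \<in> J" using ideal_zero[OF J] by simp
    then show ?thesis using ex[of "sum_list gs"] that by blast
  qed
  \<comment> \<open>\<open>pt i b\<close> is the monomial with exponent \<open>b\<close>, placed in the \<open>i\<close>-th summand.\<close>
  define pt :: "nat \<Rightarrow> ('n \<Rightarrow>\<^sub>0 nat) \<Rightarrow> ('n, 'k) mpol list" where
    "pt = (\<lambda>i b. map (\<lambda>j. if j = i then mon b else 0) [0..<length E])"
  have pt_fits: "fits (pt i b) E" if "b \<in> cone (E ! i)" for i b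
    using that by (auto simp: fits_def pt_def)
  have pt_sum: "sum_list (pt i b) = mon b" if "i < length E" for i b
    using that by (simp add: pt_def sum_list_sum_nth atLeast0LessThan)
  have pt_nth: "pt i b ! j = (if j = i then mon b else 0)" if "j < length E" for i j b
    using that by (simp add: pt_def)
  have "cone p \<subseteq> - exps J" if p: "p \<in> set E" for p
  proof
    fix b assume b: "b \<in> cone p"
    obtain i where i: "i < length E" "p = E ! i" using p unfolding in_set_conv_nth by blast
    show "b \<in> - exps J"
    proof
      assume "b \<in> exps J"
      then have "sum_list (pt i b) - sum_list (replicate (length E) 0) \<in> J"
      proof -
        have "sum_list (replicate m (0 :: ('n, 'k) mpol)) = 0" for m by (induction m) simp_all
        then show ?thesis using \<open>b \<in> exps J\<close> pt_sum[OF i(1)] by (simp add: exps_def)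
      qed
      then have "pt i b = replicate (length E) 0"
      proof (intro uniq)
        show "fits (pt i b) E" using b i(2) by (intro pt_fits) simp
      qed (simp_all add: fits_def)
      then have "pt i b ! i = 0" using i by simp
      then have "(mon b :: ('n, 'k) mpol) = 0" using pt_nth[OF i(1), of i b] by simp
      then have "Poly_Mapping.keys (mon b :: ('n, 'k) mpol) = {}" by (simp only: keys_zero)
      then show False by simp
    qed
  qed
  moreover have "\<exists>!p. p \<in> set E \<and> b \<in> cone p" if b: "b \<in> - exps J" for b
  proof (rule ex_ex1I)
    obtain fs where fs: "fits fs E" "sum_list fs - mon b \<in> J" using ex[of "mon b"] by blast
    then have "Poly_Mapping.lookup (sum_list fs - mon b) b = 0"
      using monomial_ideal_mem[OF mJ] b by (auto simp: in_keys_iff)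
    then have "(\<Sum>i<length fs. Poly_Mapping.lookup (fs ! i) b) \<noteq> 0"
      by (simp add: lookup_minus lookup_sum_list)
    then obtain i where i: "i \<in> {..<length fs}" "Poly_Mapping.lookup (fs ! i) b \<noteq> 0"
      by (rule sum.not_neutral_contains_not_neutral)
    then have "i < length E" "b \<in> Poly_Mapping.keys (fs ! i)"
      using fs(1) by (simp_all add: fits_def in_keys_iff)
    then show "\<exists>p. p \<in> set E \<and> b \<in> cone p"
      using fs(1) nth_mem[of i E] unfolding fits_def by blast
  next
    fix p q assume pq: "p \<in> set E \<and> b \<in> cone p" "q \<in> set E \<and> b \<in> cone q"
    then obtain i j where ij: "i < length E" "p = E ! i" "j < length E" "q = E ! j"
      unfolding in_set_conv_nth by auto
    have "pt i b = pt j b"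
    proof (rule uniq)
      show "fits (pt i b) E" "fits (pt j b) E" using pq ij by (auto intro: pt_fits)
      show "sum_list (pt i b) - sum_list (pt j b) \<in> J"
        using ideal_zero[OF J] by (simp add: pt_sum[OF ij(1)] pt_sum[OF ij(3)])
    qed
    then have m: "(if i = j then mon b else 0) = (mon b :: ('n, 'k) mpol)"
      using pt_nth[OF ij(1), of i b] pt_nth[OF ij(1), of j b] by simp
    have "i = j"
    proof (rule ccontr)
      assume "i \<noteq> j"
      then have "Poly_Mapping.keys (mon b :: ('n, 'k) mpol) = {}" using m by simp
      then show False by simp
    qed
    then show "p = q" using ij by simp
  qed
  ultimately show ?thesis by (simp add: cone_partition_def)
qed

text \<open>Modulo \<open>J\<close> a polynomial is the sum of its terms outside \<open>J\<close>, and each of these terms belongs to exactly one cone.\<close>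

lemma partition_imp_stanley_decomposition:
  assumes mJ: "monomial_ideal J" and P: "cone_partition (- exps J) (set E)" and E: "distinct E"
  shows "stanley_decomposition J (map (\<lambda>(a, Z). (mon a, Z)) E)"
proof -
  note J = monomial_ideal_is_ideal[OF mJ]
  have sub: "b \<notin> exps J" if "i < length E" "b \<in> cone (E ! i)" for i b
  proof -
    have "cone (E ! i) \<subseteq> - exps J" using P nth_mem[OF that(1)] unfolding cone_partition_def by blast
    then show ?thesis using that(2) by blast
  qed
  have one: "j = i" if "i < length E" "b \<in> cone (E ! i)" "j < length E" "b \<in> cone (E ! j)" for i j b
  proof -
    have "b \<in> - exps J" using sub[OF that(1,2)] by simp
    then have "\<exists>!p. p \<in> set E \<and> b \<in> cone p" using P unfolding cone_partition_def by blast
    then have "E ! i = E ! j" using that nth_mem by blast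
    then show ?thesis using E that(1,3) by (simp add: nth_eq_iff_index_eq)
  qed
  have cov: "\<exists>i<length E. b \<in> cone (E ! i)" if "b \<notin> exps J" for b
  proof -
    have "b \<in> - exps J" using that by simp
    then have "\<exists>p. p \<in> set E \<and> b \<in> cone p" using P unfolding cone_partition_def by blast
    then show ?thesis unfolding in_set_conv_nth by auto
  qed
  have lk_sum: "Poly_Mapping.lookup (sum_list fs) b = Poly_Mapping.lookup (fs ! i) b"
    if fs: "fits fs E" and i: "i < length E" "b \<in> cone (E ! i)" for fs b i
  proof -
    have "Poly_Mapping.lookup (fs ! j) b = 0" if j: "j < length E" "j \<noteq> i" for j
    proof -
      have "b \<notin> cone (E ! j)" using one[OF i j(1)] j(2) by blast
      then have "b \<notin> Poly_Mapping.keys (fs ! j)" using fs j(1) unfolding fits_def by blast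
      then show ?thesis by (simp add: in_keys_iff)
    qed
    then have "(\<Sum>j<length fs. Poly_Mapping.lookup (fs ! j) b) =
        (\<Sum>j<length fs. if j = i then Poly_Mapping.lookup (fs ! i) b else 0)"
      using fs by (intro sum.cong) (auto simp: fits_def)
    then show ?thesis using fs i(1) by (simp add: lookup_sum_list fits_def)
  qed
  have "\<exists>!fs. fits fs E \<and> sum_list fs - x \<in> J" for x
  proof (rule ex_ex1I)
    let ?fs = "map (\<lambda>p. restrict_poly (cone p) x) E"
    have fits: "fits ?fs E" by (auto simp: fits_def in_keys_iff lookup_restrict_poly split: if_splits)
    have "Poly_Mapping.lookup (sum_list ?fs - x) b = 0" if "b \<notin> exps J" for b
    proof -
      obtain i where i: "i < length E" "b \<in> cone (E ! i)" using cov \<open>b \<notin> exps J\<close> by blast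
      then show ?thesis using lk_sum[OF fits i] by (simp add: lookup_minus lookup_restrict_poly)
    qed
    then have "sum_list ?fs - x \<in> J" unfolding monomial_ideal_mem[OF mJ] by (auto simp: in_keys_iff)
    then show "\<exists>fs. fits fs E \<and> sum_list fs - x \<in> J" using fits by blast
  next
    fix fs gs assume "fits fs E \<and> sum_list fs - x \<in> J" "fits gs E \<and> sum_list gs - x \<in> J"
    then have fg: "fits fs E" "fits gs E" "sum_list fs - x \<in> J" "sum_list gs - x \<in> J" by auto
    have "sum_list fs - sum_list gs \<in> J" using ideal_diff[OF J fg(3,4)] by simp
    then have eq: "Poly_Mapping.lookup (sum_list fs) b = Poly_Mapping.lookup (sum_list gs) b" if "b \<notin> exps J" for b
      using that monomial_ideal_mem[OF mJ, of "sum_list fs - sum_list gs"]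
      by (auto simp: in_keys_iff lookup_minus)
    show "fs = gs"
    proof (rule nth_equalityI)
      show "length fs = length gs" using fg by (simp add: fits_def)
      fix i assume "i < length fs"
      then have i: "i < length E" using fg by (simp add: fits_def)
      show "fs ! i = gs ! i"
      proof (rule poly_mapping_eqI)
        fix b show "Poly_Mapping.lookup (fs ! i) b = Poly_Mapping.lookup (gs ! i) b"
        proof (cases "b \<in> cone (E ! i)")
          case True
          then show ?thesis using lk_sum[OF fg(1) i True] lk_sum[OF fg(2) i True] eq[OF sub[OF i True]] by simp
        next
          case False
          then have "b \<notin> Poly_Mapping.keys (fs ! i)" "b \<notin> Poly_Mapping.keys (gs ! i)"
            using fg i unfolding fits_def by auto
          then show ?thesis by (simp add: in_keys_iff)
        qed
      qed
    qed
  qed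
  then show ?thesis unfolding stanley_decomposition_iff[OF J] by blast
qed

definition partition_depth :: "(('n \<Rightarrow>\<^sub>0 nat) \<times> 'n set) set \<Rightarrow> enat" where
  "partition_depth P = (INF p\<in>P. enat (card (snd p)))"

text \<open>Any finite partition can be listed without repetition, so passing between lists of Stanley spaces and sets of
cones loses nothing.\<close>

lemma sdepth_eq:
  assumes mJ: "monomial_ideal (J :: ('n::finite, 'k::field) mpol set)"
  shows "sdepth J = (SUP P\<in>{P. cone_partition (- exps J) P}. partition_depth P)"
proof -
  have dep: "sdepth_decomposition (map (\<lambda>(a, Z). (mon a :: ('n, 'k) mpol, Z)) E) = partition_depth (set E)" for E
    unfolding sdepth_decomposition_def partition_depth_def by (simp add: image_image case_prod_beta)
  have "sdepth_decomposition ` {D. stanley_decomposition J D} = partition_depth ` {P. cone_partition (- exps J) P}"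
  proof (intro equalityI subsetI)
    fix s assume "s \<in> sdepth_decomposition ` {D. stanley_decomposition J D}"
    then obtain D where D: "stanley_decomposition J D" "s = sdepth_decomposition D" by blast
    have "\<forall>d\<in>set D. \<exists>p. d = (case p of (a, Z) \<Rightarrow> (mon a, Z))"
    proof
      fix d assume "d \<in> set D"
      then have "monomial (fst d)" using D(1) unfolding stanley_decomposition_def by auto
      then obtain a where "fst d = mon a" by (auto simp: monomial_def)
      then show "\<exists>p. d = (case p of (a, Z) \<Rightarrow> (mon a, Z))" by (intro exI[of _ "(a, snd d)"]) (auto simp: prod_eq_iff)
    qed
    then obtain g where "\<And>d. d \<in> set D \<Longrightarrow> d = (case g d of (a, Z) \<Rightarrow> (mon a, Z))" by metis
    then have "D = map (\<lambda>(a, Z). (mon a, Z)) (map g D)" by (simp add: map_idI comp_def)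
    then obtain E where "D = map (\<lambda>(a, Z). (mon a, Z)) E" by blast
    then show "s \<in> partition_depth ` {P. cone_partition (- exps J) P}"
      using D dep stanley_decomposition_imp_partition[OF mJ] by blast
  next
    fix s assume "s \<in> partition_depth ` {P. cone_partition (- exps J) P}"
    then obtain P where P: "cone_partition (- exps J) P" "s = partition_depth P" by blast
    then obtain E where E: "set E = P" "distinct E"
      using finite_distinct_list[of P] unfolding cone_partition_def by blast
    then have "stanley_decomposition J (map (\<lambda>(a, Z). (mon a, Z)) E)"
      using P partition_imp_stanley_decomposition[OF mJ] by blast
    moreover have "s = sdepth_decomposition (map (\<lambda>(a, Z). (mon a :: ('n, 'k) mpol, Z)) E)"
      using dep[of E] P(2) E(1) by simp
    ultimately show "s \<in> sdepth_decomposition ` {D. stanley_decomposition J D}" by blast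
  qed
  then show ?thesis unfolding sdepth_def by simp
qed

section \<open>Stanley depth modulo a regular monomial\<close>

definition exp_of :: "('n::finite \<Rightarrow> nat) \<Rightarrow> 'n \<Rightarrow>\<^sub>0 nat" where
  "exp_of f = Abs_poly_mapping f"

lemma lk_exp_of [simp]: "lk (exp_of f) i = f i"
  by (simp add: exp_of_def)

text \<open>The projection that forgets the coordinates in \<open>W\<close>. The exponent \<open>b\<close> corresponds to the pair of
\<open>erase W b\<close> and \<open>erase (- W) b\<close> under \<open>\<nat>\<^sup>n = \<nat>\<^bsup>- W\<^esup> \<times> \<nat>\<^sup>W\<close>.\<close>

definition erase :: "'n set \<Rightarrow> ('n::finite \<Rightarrow>\<^sub>0 nat) \<Rightarrow> 'n \<Rightarrow>\<^sub>0 nat" where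
  "erase W a = exp_of (\<lambda>i. if i \<in> W then 0 else lk a i)"

lemma lk_erase [simp]: "lk (erase W a) i = (if i \<in> W then 0 else lk a i)"
  by (simp add: erase_def)

lemma mem_cone_pointwise:
  "b \<in> cone (a, Z) \<longleftrightarrow> (\<forall>i. lk a i \<le> lk b i \<and> (i \<notin> Z \<longrightarrow> lk b i = lk a i))"
  by (auto simp: mem_cone exp_le_def)

lemma cone_partitionI:
  assumes "finite P" "\<And>p. p \<in> P \<Longrightarrow> cone p \<subseteq> A" "\<And>b. b \<in> A \<Longrightarrow> \<exists>!p. p \<in> P \<and> b \<in> cone p"
  shows "cone_partition A P"
  using assms unfolding cone_partition_def by simp

lemma cone_partitionE:
  assumes "cone_partition A P" "b \<in> A"
  obtains a Z where "(a, Z) \<in> P" "b \<in> cone (a, Z)"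
    "\<forall>a' Z'. (a', Z') \<in> P \<longrightarrow> b \<in> cone (a', Z') \<longrightarrow> a' = a \<and> Z' = Z"
proof -
  have ex1: "\<exists>!p. p \<in> P \<and> b \<in> cone p" using assms unfolding cone_partition_def by blast
  then obtain p where p: "p \<in> P" "b \<in> cone p" by blast
  then have "(a', Z') = p" if "(a', Z') \<in> P" "b \<in> cone (a', Z')" for a' Z'
    using ex1 that by blast
  then show thesis using p by (intro that[of "fst p" "snd p"]) auto
qed

text \<open>The traces of the cones on the coordinate subspace where all coordinates in \<open>W\<close> vanish. A cone meets this
subspace only if its apex lies in it.\<close>

definition cone_slices :: "'n set \<Rightarrow> (('n \<Rightarrow>\<^sub>0 nat) \<times> 'n set) set \<Rightarrow> (('n \<Rightarrow>\<^sub>0 nat) \<times> 'n set) set" where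
  "cone_slices W P = {(a, Z - W) | a Z. (a, Z) \<in> P \<and> (\<forall>i\<in>W. lk a i = 0)}"

lemma cone_slicesE:
  assumes "q \<in> cone_slices W P"
  obtains a Z where "q = (a, Z - W)" "(a, Z) \<in> P" "\<forall>i\<in>W. lk a i = 0"
  using assms unfolding cone_slices_def by blast

lemma cone_partition_slice:
  assumes P: "cone_partition A P"
  shows "cone_partition {b \<in> A. \<forall>i\<in>W. lk b i = 0} (cone_slices W P)" (is "cone_partition ?A ?Q")
proof -
  have sub: "b \<in> cone (a, Z - W) \<longleftrightarrow> b \<in> cone (a, Z) \<and> (\<forall>i\<in>W. lk b i = 0)"
    if "\<forall>i\<in>W. lk a i = 0" for a b Z
    using that unfolding mem_cone by auto
  have zero: "\<forall>i\<in>W. lk a i = 0" if "b \<in> cone (a, Z)" "\<forall>i\<in>W. lk b i = 0" for a b Z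
  proof
    fix i assume "i \<in> W"
    moreover have "lk a i \<le> lk b i" using that(1) by (simp add: mem_cone_pointwise)
    ultimately show "lk a i = 0" using that(2) by simp
  qed
  have "?Q \<subseteq> (\<lambda>(a, Z). (a, Z - W)) ` P" unfolding cone_slices_def by auto
  moreover have "finite P" using P unfolding cone_partition_def by blast
  ultimately have "finite ?Q" by (blast intro: finite_subset)
  moreover have "cone q \<subseteq> ?A" if "q \<in> ?Q" for q
  proof -
    obtain a Z where q: "q = (a, Z - W)" "(a, Z) \<in> P" "\<forall>i\<in>W. lk a i = 0"
      using \<open>q \<in> ?Q\<close> by (rule cone_slicesE)
    have "cone (a, Z) \<subseteq> A" using P q(2) unfolding cone_partition_def by blast
    then show ?thesis using sub[OF q(3)] unfolding q(1) by blast
  qed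
  moreover have "\<exists>!q. q \<in> ?Q \<and> b \<in> cone q" if b: "b \<in> ?A" for b
  proof -
    obtain a Z where aZ: "(a, Z) \<in> P" "b \<in> cone (a, Z)"
      and uniq: "\<forall>a' Z'. (a', Z') \<in> P \<longrightarrow> b \<in> cone (a', Z') \<longrightarrow> a' = a \<and> Z' = Z"
      using cone_partitionE[OF P, of b] b by blast
    have z: "\<forall>i\<in>W. lk a i = 0" using zero[OF aZ(2)] b by blast
    show ?thesis
    proof (rule ex1I[of _ "(a, Z - W)"])
      have "(a, Z - W) \<in> ?Q" using aZ(1) z unfolding cone_slices_def by blast
      then show "(a, Z - W) \<in> ?Q \<and> b \<in> cone (a, Z - W)" using aZ(2) sub[OF z] b by blast
      fix q assume q: "q \<in> ?Q \<and> b \<in> cone q"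
      then obtain a' Z' where q': "q = (a', Z' - W)" "(a', Z') \<in> P" "\<forall>i\<in>W. lk a' i = 0"
        by (elim conjE cone_slicesE)
      then have "b \<in> cone (a', Z')" using q sub[OF q'(3)] by blast
      then show "q = (a, Z - W)" using uniq q'(1,2) by blast
    qed
  qed
  ultimately show ?thesis by (rule cone_partitionI)
qed

lemma apex_in_partition:
  assumes "cone_partition A P" "(a, Z) \<in> P"
  shows "a \<in> A"
proof -
  have "cone (a, Z) \<subseteq> A" using assms unfolding cone_partition_def by blast
  then show ?thesis using apex_in_cone[of a Z] by blast
qed

definition cone_products ::
    "(('n \<Rightarrow>\<^sub>0 nat) \<times> 'n set) set \<Rightarrow> (('n \<Rightarrow>\<^sub>0 nat) \<times> 'n set) set \<Rightarrow> (('n \<Rightarrow>\<^sub>0 nat) \<times> 'n set) set" where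
  "cone_products Q T = {(a + v, Z \<union> Y) | a Z v Y. (a, Z) \<in> Q \<and> (v, Y) \<in> T}"

lemma cone_productsE:
  assumes "p \<in> cone_products Q T"
  obtains a Z v Y where "p = (a + v, Z \<union> Y)" "(a, Z) \<in> Q" "(v, Y) \<in> T"
  using assms unfolding cone_products_def by blast

text \<open>A cone in the coordinates outside \<open>W\<close> and one in the coordinates inside \<open>W\<close> have as their product the
cone whose apex is the sum of the apexes and whose free directions are those of both.\<close>

lemma cone_partition_product:
  assumes Q: "cone_partition A Q" "\<And>a i. a \<in> A \<Longrightarrow> i \<in> W \<Longrightarrow> lk a i = 0"
      "\<And>a Z. (a, Z) \<in> Q \<Longrightarrow> Z \<inter> W = {}"
    and T: "cone_partition C T" "\<And>c i. c \<in> C \<Longrightarrow> i \<notin> W \<Longrightarrow> lk c i = 0"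
      "\<And>v Y. (v, Y) \<in> T \<Longrightarrow> Y \<subseteq> W"
  shows "cone_partition {b. erase W b \<in> A \<and> erase (- W) b \<in> C} (cone_products Q T)"
    (is "cone_partition ?A ?P")
proof -
  have mem: "b \<in> cone (a + v, Z \<union> Y) \<longleftrightarrow> erase W b \<in> cone (a, Z) \<and> erase (- W) b \<in> cone (v, Y)"
    if aZ: "(a, Z) \<in> Q" and vY: "(v, Y) \<in> T" for a v Z Y b
  proof -
    have a: "lk a i = 0 \<and> i \<notin> Z" if "i \<in> W" for i
      using Q(2)[OF apex_in_partition[OF Q(1) aZ] that] Q(3)[OF aZ] that by blast
    have v: "lk v i = 0 \<and> i \<notin> Y" if "i \<notin> W" for i
      using T(2)[OF apex_in_partition[OF T(1) vY] that] T(3)[OF vY] that by blast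
    have "(lk (a + v) i \<le> lk b i \<and> (i \<notin> Z \<union> Y \<longrightarrow> lk b i = lk (a + v) i)) \<longleftrightarrow>
        (lk a i \<le> lk (erase W b) i \<and> (i \<notin> Z \<longrightarrow> lk (erase W b) i = lk a i)) \<and>
        (lk v i \<le> lk (erase (- W) b) i \<and> (i \<notin> Y \<longrightarrow> lk (erase (- W) b) i = lk v i))" for i
      by (cases "i \<in> W") (use a[of i] v[of i] in \<open>auto simp: lookup_add\<close>)
    then show ?thesis unfolding mem_cone_pointwise by blast
  qed
  have "?P \<subseteq> (\<lambda>((a, Z), (v, Y)). (a + v, Z \<union> Y)) ` (Q \<times> T)"
    unfolding cone_products_def by force
  moreover have "finite (Q \<times> T)" using Q(1) T(1) unfolding cone_partition_def by blast
  ultimately have "finite ?P" by (blast intro: finite_subset)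
  moreover have "cone p \<subseteq> ?A" if "p \<in> ?P" for p
  proof -
    obtain a Z v Y where p: "p = (a + v, Z \<union> Y)" "(a, Z) \<in> Q" "(v, Y) \<in> T"
      using \<open>p \<in> ?P\<close> by (rule cone_productsE)
    have "cone (a, Z) \<subseteq> A" "cone (v, Y) \<subseteq> C"
      using Q(1) T(1) p(2,3) unfolding cone_partition_def by blast+
    then show ?thesis using mem[OF p(2,3)] unfolding p(1) by blast
  qed
  moreover have "\<exists>!p. p \<in> ?P \<and> b \<in> cone p" if b: "b \<in> ?A" for b
  proof -
    obtain a Z where q: "(a, Z) \<in> Q" "erase W b \<in> cone (a, Z)"
      and uq: "\<forall>a' Z'. (a', Z') \<in> Q \<longrightarrow> erase W b \<in> cone (a', Z') \<longrightarrow> a' = a \<and> Z' = Z"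
      using cone_partitionE[OF Q(1), of "erase W b"] b by blast
    obtain v Y where t: "(v, Y) \<in> T" "erase (- W) b \<in> cone (v, Y)"
      and ut: "\<forall>v' Y'. (v', Y') \<in> T \<longrightarrow> erase (- W) b \<in> cone (v', Y') \<longrightarrow> v' = v \<and> Y' = Y"
      using cone_partitionE[OF T(1), of "erase (- W) b"] b by blast
    show ?thesis
    proof (rule ex1I[of _ "(a + v, Z \<union> Y)"])
      have "(a + v, Z \<union> Y) \<in> ?P" using q(1) t(1) unfolding cone_products_def by blast
      then show "(a + v, Z \<union> Y) \<in> ?P \<and> b \<in> cone (a + v, Z \<union> Y)"
        using q(2) t(2) mem[OF q(1) t(1)] by blast
      fix p assume p: "p \<in> ?P \<and> b \<in> cone p"
      then obtain a' Z' v' Y' where p': "p = (a' + v', Z' \<union> Y')" "(a', Z') \<in> Q" "(v', Y') \<in> T"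
        by (elim conjE cone_productsE)
      then have "erase W b \<in> cone (a', Z')" "erase (- W) b \<in> cone (v', Y')"
        using p mem[OF p'(2,3)] by blast+
      then show "p = (a + v, Z \<union> Y)" using uq ut p' by blast
    qed
  qed
  ultimately show ?thesis by (rule cone_partitionI)
qed

lemma cone_partition_Un:
  assumes P: "cone_partition A P" and Q: "cone_partition B Q" and AB: "A \<inter> B = {}"
  shows "cone_partition (A \<union> B) (P \<union> Q)"
proof (rule cone_partitionI)
  have sub: "cone p \<subseteq> A" if "p \<in> P" for p using P that unfolding cone_partition_def by blast
  have subQ: "cone q \<subseteq> B" if "q \<in> Q" for q using Q that unfolding cone_partition_def by blast
  show "finite (P \<union> Q)" using P Q unfolding cone_partition_def by blast
  show "cone p \<subseteq> A \<union> B" if "p \<in> P \<union> Q" for p using that sub subQ by blast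
  show "\<exists>!p. p \<in> P \<union> Q \<and> b \<in> cone p" if "b \<in> A \<union> B" for b
  proof (cases "b \<in> A")
    case True
    then have "\<not> (p \<in> Q \<and> b \<in> cone p)" for p using subQ AB by blast
    then have "(\<lambda>p. p \<in> P \<union> Q \<and> b \<in> cone p) = (\<lambda>p. p \<in> P \<and> b \<in> cone p)" by blast
    moreover have "\<exists>!p. p \<in> P \<and> b \<in> cone p" using P True unfolding cone_partition_def by blast
    ultimately show ?thesis by simp
  next
    case False
    then have "\<not> (p \<in> P \<and> b \<in> cone p)" for p using sub by blast
    then have "(\<lambda>p. p \<in> P \<union> Q \<and> b \<in> cone p) = (\<lambda>p. p \<in> Q \<and> b \<in> cone p)" by blast
    moreover have "b \<in> B" using False that by blast
    then have "\<exists>!p. p \<in> Q \<and> b \<in> cone p" using Q unfolding cone_partition_def by blast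
    ultimately show ?thesis by simp
  qed
qed

lemma cone_partition_coordinate_space:
  "cone_partition {c. \<forall>i. i \<notin> W \<longrightarrow> lk c i = 0} {(0, W)}"
proof -
  have "cone (0, W) = {c. \<forall>i. i \<notin> W \<longrightarrow> lk c i = 0}" by (auto simp: mem_cone_pointwise)
  then show ?thesis unfolding cone_partition_def by auto
qed

lemma cone_partition_ray:
  "cone_partition {c. (\<forall>i. i \<noteq> w \<longrightarrow> lk c i = 0) \<and> k \<le> lk c w} {(Poly_Mapping.single w k, {w})}"
proof -
  have "b \<in> cone (Poly_Mapping.single w k, {w}) \<longleftrightarrow> (\<forall>i. i \<noteq> w \<longrightarrow> lk b i = 0) \<and> k \<le> lk b w" for b
    unfolding mem_cone exp_le_single_iff by (auto simp: lookup_single when_def)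
  then have "cone (Poly_Mapping.single w k, {w}) = {c. (\<forall>i. i \<noteq> w \<longrightarrow> lk c i = 0) \<and> k \<le> lk c w}"
    by blast
  then show ?thesis unfolding cone_partition_def by auto
qed

lemma cone_partition_segment:
  "cone_partition {c. (\<forall>i. i \<noteq> w \<longrightarrow> lk c i = 0) \<and> lk c w < k}
    ((\<lambda>t. (Poly_Mapping.single w t, {})) ` {..<k})"
proof -
  have c: "b \<in> cone (Poly_Mapping.single w t, {}) \<longleftrightarrow> b = Poly_Mapping.single w t" for b t
    by (auto simp: mem_cone_pointwise intro: poly_mapping_eqI)
  have b: "(\<forall>i. i \<noteq> w \<longrightarrow> lk b i = 0) \<and> lk b w < k \<longleftrightarrow> (\<exists>t<k. b = Poly_Mapping.single w t)" for b
  proof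
    assume b: "(\<forall>i. i \<noteq> w \<longrightarrow> lk b i = 0) \<and> lk b w < k"
    then have "b = Poly_Mapping.single w (lk b w)"
      by (intro poly_mapping_eqI) (simp add: lookup_single when_def)
    then show "\<exists>t<k. b = Poly_Mapping.single w t" using b by blast
  qed (auto simp: lookup_single when_def)
  show ?thesis unfolding cone_partition_def b by (auto simp: c)
qed

text \<open>Induction on \<open>W\<close>, splitting by whether the new coordinate \<open>c\<^sub>w\<close> is smaller than \<open>e\<^sub>w\<close>. If it is, the
other coordinates are free, and each value of \<open>c\<^sub>w\<close> contributes one cone. If not, the others lie in the
smaller staircase, and \<open>c\<^sub>w\<close> becomes one more free direction, starting at \<open>e\<^sub>w\<close>.\<close>

lemma staircase_partition:
  fixes e :: "'n::finite \<Rightarrow>\<^sub>0 nat"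
  shows "\<exists>T. cone_partition {c. (\<forall>i. i \<notin> W \<longrightarrow> lk c i = 0) \<and> \<not> (\<forall>i\<in>W. lk e i \<le> lk c i)} T \<and>
    (\<forall>(v, Y)\<in>T. Y \<subseteq> W \<and> Suc (card Y) = card W)"
proof -
  have "finite W" by simp
  then show ?thesis
  proof (induction W rule: finite_induct)
    case empty
    then show ?case by (intro exI[of _ "{}"]) (simp add: cone_partition_def)
  next
    case (insert w W)
    let ?C = "{c. (\<forall>i. i \<notin> W \<longrightarrow> lk c i = 0) \<and> \<not> (\<forall>i\<in>W. lk e i \<le> lk c i)}"
    obtain T where T: "cone_partition ?C T" "\<forall>(v, Y)\<in>T. Y \<subseteq> W \<and> Suc (card Y) = card W"
      using insert.IH by (elim exE conjE)
    have T2: "Y \<subseteq> W \<and> Suc (card Y) = card W" if "(v, Y) \<in> T" for v Y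
      using T(2) that by auto
    let ?T1 = "cone_products {(0, W)} ((\<lambda>t. (Poly_Mapping.single w t, {})) ` {..<lk e w})"
    let ?T2 = "cone_products T {(Poly_Mapping.single w (lk e w), {w})}"
    let ?A1 = "{b. erase {w} b \<in> {c. \<forall>i. i \<notin> W \<longrightarrow> lk c i = 0} \<and>
      erase (- {w}) b \<in> {c. (\<forall>i. i \<noteq> w \<longrightarrow> lk c i = 0) \<and> lk c w < lk e w}}"
    let ?A2 = "{b. erase {w} b \<in> ?C \<and>
      erase (- {w}) b \<in> {c. (\<forall>i. i \<noteq> w \<longrightarrow> lk c i = 0) \<and> lk e w \<le> lk c w}}"
    have p1: "cone_partition ?A1 ?T1"
      by (rule cone_partition_product[OF cone_partition_coordinate_space _ _ cone_partition_segment])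
        (use insert.hyps in auto)
    have p2: "cone_partition ?A2 ?T2"
      by (rule cone_partition_product[OF T(1) _ _ cone_partition_ray])
        (use insert.hyps T2 in auto)
    have "cone_partition (?A1 \<union> ?A2) (?T1 \<union> ?T2)"
      by (rule cone_partition_Un[OF p1 p2]) auto
    moreover have "?A1 \<union> ?A2 = {c. (\<forall>i. i \<notin> insert w W \<longrightarrow> lk c i = 0) \<and>
        \<not> (\<forall>i\<in>insert w W. lk e i \<le> lk c i)}"
    proof (intro Set.set_eqI)
      fix b
      have z: "(\<forall>i. i \<notin> W \<longrightarrow> lk (erase {w} b) i = 0) \<longleftrightarrow> (\<forall>i. i \<notin> insert w W \<longrightarrow> lk b i = 0)" by auto
      have l: "(\<forall>i\<in>W. lk e i \<le> lk (erase {w} b) i) \<longleftrightarrow> (\<forall>i\<in>W. lk e i \<le> lk b i)"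
        using insert.hyps(2) by (intro ball_cong) auto
      show "b \<in> ?A1 \<union> ?A2 \<longleftrightarrow> b \<in> {c. (\<forall>i. i \<notin> insert w W \<longrightarrow> lk c i = 0) \<and>
          \<not> (\<forall>i\<in>insert w W. lk e i \<le> lk c i)}"
        unfolding Un_iff mem_Collect_eq z l by (auto simp: not_le)
    qed
    moreover have "snd p \<subseteq> insert w W \<and> Suc (card (snd p)) = card (insert w W)"
      if "p \<in> ?T1 \<union> ?T2" for p
      using that
    proof
      assume "p \<in> ?T1"
      then have "snd p = W" by (auto elim: cone_productsE)
      then show ?thesis using insert.hyps by auto
    next
      assume "p \<in> ?T2"
      then obtain v Y where Y: "(v, Y) \<in> T" "snd p = Y \<union> {w}" by (auto elim: cone_productsE)
      have "Y \<subseteq> W" "Suc (card Y) = card W" using T2[OF Y(1)] by auto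
      moreover from this have "w \<notin> Y" "finite Y" using insert.hyps by (auto intro: finite_subset)
      ultimately show ?thesis using insert.hyps Y(2) by auto
    qed
    then have "\<forall>(v, Y)\<in>?T1 \<union> ?T2. Y \<subseteq> insert w W \<and> Suc (card Y) = card (insert w W)" by fastforce
    ultimately show ?case by (intro exI[of _ "?T1 \<union> ?T2"]) simp
  qed
qed

text \<open>Let \<open>N\<close> bound all exponents of a finite set of monomial generators of \<open>J\<close>. Replacing each coordinate \<open>b\<^sub>i\<close>
by \<open>min b\<^sub>i N\<close> does not affect membership in \<open>J\<close>, and the fibres of this map are cones, free in the directions
where the value \<open>N\<close> is attained. That a decomposition exists matters: the supremum over none at all
would be \<open>0\<close>.\<close>

lemma cone_partition_exists:
  assumes J: "is_ideal (J :: ('n::finite, 'k::field) mpol set)"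
  shows "\<exists>P. cone_partition (- exps J) P"
proof -
  obtain B where B: "finite B" "B \<subseteq> exps J" "\<And>a. a \<in> exps J \<Longrightarrow> \<exists>b\<in>B. exp_le b a"
    using dickson[of "exps J"] by blast
  define N where "N = sum exp_deg B"
  have N: "lk b i \<le> N" if b: "b \<in> B" for b i
  proof -
    have "lk b i \<le> exp_deg b" unfolding exp_deg_def by (rule member_le_sum) auto
    also have "\<dots> \<le> N" unfolding N_def using b B(1) by (intro member_le_sum) auto
    finally show ?thesis .
  qed
  define cut where "cut = (\<lambda>b :: 'n \<Rightarrow>\<^sub>0 nat. exp_of (\<lambda>i. min (lk b i) N))"
  have cut: "b \<in> exps J \<longleftrightarrow> cut b \<in> exps J" for b
  proof
    assume "b \<in> exps J"
    then obtain a where a: "a \<in> B" "exp_le a b" using B(3) by blast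
    then have "exp_le a (cut b)" using N[OF a(1)] by (simp add: exp_le_def cut_def)
    then show "cut b \<in> exps J" using exps_up[OF J] a(1) B(2) by blast
  next
    have "exp_le (cut b) b" by (simp add: exp_le_def cut_def)
    then show "cut b \<in> exps J \<Longrightarrow> b \<in> exps J" using exps_up[OF J] by blast
  qed
  define S where "S = {c. c \<notin> exps J \<and> (\<forall>i. lk c i \<le> N)}"
  have mem: "b \<in> cone (c, {i. lk c i = N}) \<longleftrightarrow> cut b = c" if c: "c \<in> S" for b c
  proof -
    have "(lk c i \<le> lk b i \<and> (i \<notin> {i. lk c i = N} \<longrightarrow> lk b i = lk c i)) \<longleftrightarrow> lk (cut b) i = lk c i" for i
    proof -
      have "lk c i \<le> N" using c by (simp add: S_def)
      then show ?thesis by (cases "lk c i = N") (auto simp: cut_def min_def)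
    qed
    then have "b \<in> cone (c, {i. lk c i = N}) \<longleftrightarrow> (\<forall>i. lk (cut b) i = lk c i)"
      unfolding mem_cone_pointwise by simp
    also have "\<dots> \<longleftrightarrow> cut b = c" by (auto intro: poly_mapping_eqI)
    finally show ?thesis .
  qed
  have "S \<subseteq> exp_of ` (UNIV \<rightarrow>\<^sub>E {..N})"
  proof
    fix c assume "c \<in> S"
    then have "c = exp_of (lk c)" "lk c \<in> UNIV \<rightarrow>\<^sub>E {..N}"
      by (simp_all add: S_def poly_mapping_eqI PiE_iff)
    then show "c \<in> exp_of ` (UNIV \<rightarrow>\<^sub>E {..N})" by (rule image_eqI)
  qed
  moreover have "finite (exp_of ` (UNIV \<rightarrow>\<^sub>E {..N}) :: ('n \<Rightarrow>\<^sub>0 nat) set)"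
    by (intro finite_imageI finite_PiE) simp_all
  ultimately have "finite S" by (rule finite_subset)
  have cS: "cut b \<in> S" if "b \<notin> exps J" for b
  proof -
    have "cut b \<notin> exps J" using that cut[of b] by simp
    moreover have "lk (cut b) i \<le> N" for i by (simp add: cut_def)
    ultimately show ?thesis by (simp add: S_def)
  qed
  let ?P = "(\<lambda>c. (c, {i. lk c i = N})) ` S"
  have "cone_partition (- exps J) ?P"
  proof (rule cone_partitionI)
    show "finite ?P" using \<open>finite S\<close> by (rule finite_imageI)
  next
    fix p assume "p \<in> ?P"
    then obtain c where c: "c \<in> S" "p = (c, {i. lk c i = N})" by blast
    have "c \<notin> exps J" using c(1) by (simp add: S_def)
    show "cone p \<subseteq> - exps J"
    proof
      fix b assume "b \<in> cone p"
      then have "cut b = c" using mem[OF c(1)] c(2) by simp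
      then show "b \<in> - exps J" using cut[of b] \<open>c \<notin> exps J\<close> by simp
    qed
  next
    fix b assume "b \<in> - exps J"
    then have bS: "cut b \<in> S" using cS by blast
    show "\<exists>!p. p \<in> ?P \<and> b \<in> cone p"
    proof (rule ex1I)
      show "(cut b, {i. lk (cut b) i = N}) \<in> ?P \<and> b \<in> cone (cut b, {i. lk (cut b) i = N})"
        using bS mem[OF bS] by simp
      fix p assume p: "p \<in> ?P \<and> b \<in> cone p"
      then obtain c where "c \<in> S" "p = (c, {i. lk c i = N})" by blast
      then show "p = (cut b, {i. lk (cut b) i = N})" using p mem by simp
    qed
  qed
  then show ?thesis by blast
qed

text \<open>Adding a large multiple of \<open>e\<close> to the exponent with erased coordinates produces a multiple of \<open>b\<close>; as
\<open>x\<^sup>e\<close> is regular modulo \<open>J\<close>, it can be cancelled again.\<close>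

lemma exps_erase_iff:
  fixes J :: "('n::finite, 'k::field) mpol set"
  assumes J: "is_ideal J" and reg: "regular_mod J (mon e)"
  shows "erase (Poly_Mapping.keys e) b \<in> exps J \<longleftrightarrow> b \<in> exps J"
proof
  let ?W = "Poly_Mapping.keys e"
  have "exp_le (erase ?W b) b" by (simp add: exp_le_def)
  then show "erase ?W b \<in> exps J \<Longrightarrow> b \<in> exps J" by (rule exps_up[OF J, rotated])
  assume b: "b \<in> exps J"
  have cancel: "a \<in> exps J" if "exp_of (\<lambda>i. m * lk e i) + a \<in> exps J" for m a
    using that
  proof (induction m)
    case 0
    moreover have "exp_of (\<lambda>i. 0 * lk e i) = 0" by (rule poly_mapping_eqI) simp
    ultimately show ?case by simp
  next
    case (Suc m)
    have "exp_of (\<lambda>i. Suc m * lk e i) + a = e + (exp_of (\<lambda>i. m * lk e i) + a)"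
      by (rule poly_mapping_eqI) (simp add: lookup_add)
    then have "mon e * mon (exp_of (\<lambda>i. m * lk e i) + a) \<in> J"
      using Suc.prems by (simp only: exps_def mem_Collect_eq mon_add)
    then have "exp_of (\<lambda>i. m * lk e i) + a \<in> exps J" using reg by (simp add: regular_mod_def exps_def)
    then show ?case by (rule Suc.IH)
  qed
  have "lk b i \<le> exp_deg b * lk e i" if "i \<in> ?W" for i
  proof -
    have "lk b i \<le> exp_deg b" unfolding exp_deg_def by (rule member_le_sum) auto
    also have "\<dots> \<le> exp_deg b * lk e i" using that by (simp add: in_keys_iff)
    finally show ?thesis .
  qed
  then have "exp_le b (exp_of (\<lambda>i. exp_deg b * lk e i) + erase ?W b)"
    by (simp add: exp_le_def lookup_add)
  then show "erase ?W b \<in> exps J" using cancel exps_up[OF J b] by blast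
qed

lemma eSuc_Inf: "eSuc (Inf A) = Inf (eSuc ` A)"
proof (cases "A = {}")
  case True
  then show ?thesis by (simp add: Inf_enat_def)
next
  case False
  then have "Inf A \<in> A" by (auto intro: wellorder_InfI)
  then have "Inf (eSuc ` A) \<le> eSuc (Inf A)" by (intro Inf_lower) auto
  moreover have "eSuc (Inf A) \<le> Inf (eSuc ` A)" by (auto intro!: Inf_greatest Inf_lower)
  ultimately show ?thesis by (rule antisym[rotated])
qed

text \<open>Write the complements of \<open>I\<close> and \<open>(I, x\<^sup>e)\<close> as \<open>A \<times> \<nat>\<^sup>W\<close> and \<open>A \<times> {c. \<not> e \<le> c}\<close>. From a partition of
the first, slice to \<open>A\<close>, losing at most \<open>|W|\<close> dimensions, and multiply by the staircase of
dimension \<open>|W| - 1\<close>. From a partition of the second, slice to \<open>A\<close>, losing at most \<open>|W| - 1\<close> dimensions because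
no cone there contains all directions of \<open>W\<close>, and multiply by \<open>\<nat>\<^sup>W\<close>.\<close>

lemma sdepth_mod_regular:
  fixes I :: "('n::finite, 'k::field) mpol set"
  assumes mI: "monomial_ideal I" and e: "e \<noteq> 0" and reg: "regular_mod I (mon e)"
  shows "sdepth I = eSuc (sdepth (gen (insert (mon e) I)))"
proof -
  define J where "J = gen (insert (mon e) I)"
  note I = monomial_ideal_is_ideal[OF mI]
  have mJ: "monomial_ideal J" and eJ: "exps J = exps I \<union> {a. exp_le e a}"
    unfolding J_def by (rule gen_insert_monomial[OF mI])+
  let ?W = "Poly_Mapping.keys e"
  have W: "?W \<noteq> {}" using e by simp
  have eW: "exp_le e b \<longleftrightarrow> (\<forall>i\<in>?W. lk e i \<le> lk b i)" for b
    by (auto simp: exp_le_def in_keys_iff)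
  note erase_iff = exps_erase_iff[OF I reg]
  let ?A = "{b \<in> - exps I. \<forall>i\<in>?W. lk b i = 0}"
  have not_le: "\<not> exp_le e b" if "\<forall>i\<in>?W. lk b i = 0" for b
  proof -
    obtain i where "i \<in> ?W" using W by blast
    then have "lk b i < lk e i" using that by (auto simp: in_keys_iff)
    then show ?thesis unfolding exp_le_def using not_le by blast
  qed
  have AJ: "?A = {b \<in> - exps J. \<forall>i\<in>?W. lk b i = 0}" using not_le eJ by auto
  have down: "\<exists>P'. cone_partition (- exps J) P' \<and>
      (\<forall>p'\<in>P'. \<exists>p\<in>P. card (snd p) \<le> Suc (card (snd p')))" if P: "cone_partition (- exps I) P" for P
  proof -
    obtain T where T: "cone_partition {c. (\<forall>i. i \<notin> ?W \<longrightarrow> lk c i = 0) \<and> \<not> (\<forall>i\<in>?W. lk e i \<le> lk c i)} T"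
      "\<forall>(v, Y)\<in>T. Y \<subseteq> ?W \<and> Suc (card Y) = card ?W"
      using staircase_partition[of ?W e] by (elim exE conjE)
    have T2: "Y \<subseteq> ?W \<and> Suc (card Y) = card ?W" if "(v, Y) \<in> T" for v Y
      using T(2) that by auto
    let ?P = "cone_products (cone_slices ?W P) T"
    have "cone_partition {b. erase ?W b \<in> ?A \<and>
        erase (- ?W) b \<in> {c. (\<forall>i. i \<notin> ?W \<longrightarrow> lk c i = 0) \<and> \<not> (\<forall>i\<in>?W. lk e i \<le> lk c i)}} ?P"
      by (rule cone_partition_product[OF cone_partition_slice[OF P] _ _ T(1)]) (use T2 in \<open>auto elim: cone_slicesE\<close>)
    moreover have "{b. erase ?W b \<in> ?A \<and>
        erase (- ?W) b \<in> {c. (\<forall>i. i \<notin> ?W \<longrightarrow> lk c i = 0) \<and> \<not> (\<forall>i\<in>?W. lk e i \<le> lk c i)}} = - exps J"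
      using erase_iff by (auto simp: eJ eW)
    moreover have "\<exists>p\<in>P. card (snd p) \<le> Suc (card (snd p'))" if p': "p' \<in> ?P" for p'
    proof -
      obtain a Z v Y where p: "(a, Z) \<in> P" "(v, Y) \<in> T" "snd p' = (Z - ?W) \<union> Y"
        using p' by (auto elim!: cone_productsE cone_slicesE)
      have Y: "Y \<subseteq> ?W" "Suc (card Y) = card ?W" using T2[OF p(2)] by auto
      have "card Z \<le> card ((Z - ?W) \<union> ?W)" by (intro card_mono) auto
      also have "\<dots> \<le> card (Z - ?W) + card ?W" by (rule card_Un_le)
      also have "\<dots> = Suc (card (Z - ?W) + card Y)" using Y(2) by simp
      also have "card (Z - ?W) + card Y = card ((Z - ?W) \<union> Y)"
        using Y(1) by (intro card_Un_disjoint[symmetric]) auto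
      finally show ?thesis using p by (intro bexI[of _ "(a, Z)"]) auto
    qed
    ultimately show ?thesis by (intro exI[of _ ?P]) simp
  qed
  have up: "\<exists>P. cone_partition (- exps I) P \<and>
      (\<forall>p\<in>P. \<exists>p'\<in>P'. Suc (card (snd p')) \<le> card (snd p))" if P': "cone_partition (- exps J) P'" for P'
  proof -
    let ?P = "cone_products (cone_slices ?W P') {(0, ?W)}"
    have "cone_partition {b. erase ?W b \<in> ?A \<and> erase (- ?W) b \<in> {c. \<forall>i. i \<notin> ?W \<longrightarrow> lk c i = 0}} ?P"
      unfolding AJ
      by (rule cone_partition_product[OF cone_partition_slice[OF P'] _ _ cone_partition_coordinate_space])
        (auto elim: cone_slicesE)
    moreover have "{b. erase ?W b \<in> ?A \<and> erase (- ?W) b \<in> {c. \<forall>i. i \<notin> ?W \<longrightarrow> lk c i = 0}} = - exps I"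
      using erase_iff by auto
    moreover have "\<exists>p'\<in>P'. Suc (card (snd p')) \<le> card (snd p)" if p: "p \<in> ?P" for p
    proof -
      obtain a Z where aZ: "(a, Z) \<in> P'" "snd p = (Z - ?W) \<union> ?W"
        using p by (auto elim!: cone_productsE cone_slicesE)
      have "\<not> ?W \<subseteq> Z"
      proof
        assume "?W \<subseteq> Z"
        then have "a + e \<in> cone (a, Z)" by (auto simp: mem_cone lookup_add in_keys_iff)
        moreover have "cone (a, Z) \<subseteq> - exps J" using P' aZ(1) unfolding cone_partition_def by blast
        ultimately show False by (auto simp: eJ)
      qed
      then have "Z \<subset> (Z - ?W) \<union> ?W" by auto
      then have "card Z < card ((Z - ?W) \<union> ?W)" by (intro psubset_card_mono) auto
      then show ?thesis using aZ by (intro bexI[of _ "(a, Z)"]) auto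
    qed
    ultimately show ?thesis by (intro exI[of _ ?P]) simp
  qed
  let ?SI = "SUP P\<in>{P. cone_partition (- exps I) P}. partition_depth P"
  let ?SJ = "SUP P\<in>{P. cone_partition (- exps J) P}. partition_depth P"
  have eSuc_depth: "eSuc (partition_depth P) = (INF p\<in>P. enat (Suc (card (snd p))))" for P :: "(('n \<Rightarrow>\<^sub>0 nat) \<times> 'n set) set"
    unfolding partition_depth_def eSuc_Inf by (simp add: image_image eSuc_enat)
  have "?SI \<le> eSuc ?SJ"
  proof (rule SUP_least)
    fix P assume "P \<in> {P. cone_partition (- exps I) P}"
    then obtain P' where P': "cone_partition (- exps J) P'"
      "\<And>p'. p' \<in> P' \<Longrightarrow> \<exists>p\<in>P. card (snd p) \<le> Suc (card (snd p'))" using down by blast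
    have "partition_depth P \<le> eSuc (partition_depth P')"
      unfolding eSuc_depth unfolding partition_depth_def
      by (rule INF_mono) (use P'(2) in auto)
    also have "\<dots> \<le> eSuc ?SJ" using P'(1) by (auto intro: SUP_upper)
    finally show "partition_depth P \<le> eSuc ?SJ" .
  qed
  moreover have "eSuc ?SJ \<le> ?SI"
  proof -
    have "partition_depth ` {P. cone_partition (- exps J) P} \<noteq> {}"
      using cone_partition_exists[OF monomial_ideal_is_ideal[OF mJ]] by blast
    then have "eSuc ?SJ = (SUP s\<in>partition_depth ` {P. cone_partition (- exps J) P}. eSuc s)"
      by (rule eSuc_Sup)
    also have "\<dots> \<le> ?SI"
    proof (rule SUP_least)
      fix s assume "s \<in> partition_depth ` {P. cone_partition (- exps J) P}"
      then obtain P' where P': "cone_partition (- exps J) P'" "s = partition_depth P'" by blast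
      then obtain P where P: "cone_partition (- exps I) P"
        "\<And>p. p \<in> P \<Longrightarrow> \<exists>p'\<in>P'. Suc (card (snd p')) \<le> card (snd p)" using up by blast
      have "eSuc s \<le> partition_depth P"
        unfolding P'(2) eSuc_depth unfolding partition_depth_def
        by (rule INF_mono) (use P(2) in auto)
      also have "\<dots> \<le> ?SI" using P(1) by (auto intro: SUP_upper)
      finally show "eSuc s \<le> ?SI" .
    qed
    finally show ?thesis .
  qed
  ultimately show ?thesis unfolding sdepth_eq[OF mI] J_def[symmetric] sdepth_eq[OF mJ] by (rule antisym)
qed

section \<open>Filter-regular sequences of monomials\<close>

lemma stanley_conjecture_filter_regular:
  fixes I :: "('n::finite, 'k::field) mpol set"
  assumes mI: "monomial_ideal I" and e: "e \<noteq> 0"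
    and fr: "mon e \<notin> \<Union>(assoc_primes I - {max_ideal})"
  shows "stanley_conjecture I \<longleftrightarrow> stanley_conjecture (gen (insert (mon e) I))"
proof (cases "I = UNIV")
  case True
  then have "gen (insert (mon e) I) = I" using gen_superset[of "insert (mon e) I"] by auto
  then show ?thesis by simp
next
  case False
  let ?J = "gen (insert (mon e) I)"
  note I = monomial_ideal_is_ideal[OF mI]
  have Im: "I \<subseteq> max_ideal" by (rule monomial_ideal_subset_max_ideal[OF mI False])
  have em: "mon e \<in> max_ideal" using e by (simp add: mon_in_max_ideal)
  have Jm: "?J \<subseteq> max_ideal" using Im em by (intro gen_minimal max_ideal_ideal) auto
  have "range var \<subseteq> (max_ideal :: ('n, 'k) mpol set)" unfolding max_ideal_gen by (rule gen_superset)
  then have sat: "regular_mod (sat (range var) I) (mon e)"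
    using fr by (intro mpol.regular_mod_sat I) auto
  show ?thesis
  proof (cases "has_socle max_ideal I")
    case True
    then have "has_socle max_ideal ?J" by (rule socle_mod_filter_regular[OF mI e sat])
    then show ?thesis
      using depth_eq_0[OF I Im True] depth_eq_0[OF gen_ideal Jm] by (simp add: stanley_conjecture_def)
  next
    case False
    then have reg: "regular_mod I (mon e)" by (rule filter_regular_imp_regular[OF I sat])
    show ?thesis
      unfolding stanley_conjecture_def depth_mod_regular[OF I Im em reg] sdepth_mod_regular[OF mI e reg]
      by simp
  qed
qed

theorem theorem3p6:
  fixes I :: "('n::finite, 'k::field) mpol set" and us :: "('n, 'k) mpol list"
  assumes "monomial_ideal I"
    and "\<forall>u\<in>set us. monomial u"
    and "filter_regular_seq (S_mod I) us"
  shows "stanley_conjecture I \<longleftrightarrow> stanley_conjecture (Idl\<^bsub>poly_ring\<^esub> (I \<union> set us))"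
proof -
  note I = monomial_ideal_is_ideal[OF assms(1)]
  have "monomial_ideal (gen (I \<union> set (take k us))) \<and>
      (stanley_conjecture I \<longleftrightarrow> stanley_conjecture (gen (I \<union> set (take k us))))"
    if "k \<le> length us" for k
    using that
  proof (induction k)
    case 0
    then show ?case using assms(1) I gen_eq_self[of I] by simp
  next
    case (Suc k)
    let ?J = "gen (I \<union> set (take k us))"
    have k: "k < length us" using Suc.prems by simp
    have mJ: "monomial_ideal ?J" and IH: "stanley_conjecture I \<longleftrightarrow> stanley_conjecture ?J"
      using Suc by auto
    have fr: "filter_regular_elem (quot_by poly_ring (S_mod I) (take k us)) (us ! k)"
      using assms(3) k by (simp add: filter_regular_seq_def)
    then obtain e where e: "us ! k = mon e" by (auto simp: filter_regular_elem_def monomial_def)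
    have "e \<noteq> 0"
    proof
      assume "e = 0"
      then have "us ! k = \<one>\<^bsub>poly_ring\<^esub>" using e by (simp add: poly_ring_def)
      moreover have "\<one>\<^bsub>poly_ring\<^esub> \<in> Units (poly_ring :: ('n, 'k) mpol ring)"
        using poly_ring_cring monoid.Units_one_closed by (metis cring.axioms(1) ring.is_monoid)
      ultimately show False using fr by (simp add: filter_regular_elem_def)
    qed
    moreover have "mon e \<notin> \<Union>(assoc_primes ?J - {max_ideal})"
      using fr unfolding filter_regular_elem_def e Ass_quot_by[OF I] by blast
    ultimately have step: "stanley_conjecture ?J \<longleftrightarrow> stanley_conjecture (gen (insert (mon e) ?J))"
      by (rule stanley_conjecture_filter_regular[OF mJ])
    have "gen (insert (mon e) ?J) = gen (I \<union> set (take (Suc k) us))"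
      using gen_gen_Un[of "I \<union> set (take k us)" "{mon e}"] by (simp add: take_Suc_conv_app_nth[OF k] e)
    then show ?case using step IH gen_insert_monomial(1)[OF mJ, of e] by simp
  qed
  from this[of "length us"] show ?thesis by (simp add: Idl_poly_ring)
qed

end
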